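(* Let $D$ be a connected diagram of a link with $N$ crossings such that the associated graph $G_{s_+}(D)$ has no loops (i.e. $D$ is $+$-adequate) and $G_{s_+}(D)$ has an even $n$-cycle with a singular edge (an edge of the cycle that is not part of a 2-gon). Then $H_{N-4,\,N+2|s_+|-8}(D)$ has $\mathbb{Z}_2$ torsion (contains a subgroup isomorphic to $\mathbb{Z}_2=\mathbb{Z}/2$).
   Context: Khovanov homology (framed unoriented version). A link diagram $D$ is a diagram on the disc of an unoriented framed link in the 3-ball. A Kauffman state $s$ of $D$ assigns to each crossing a marker $+1$ or $-1$. The smoothing of a crossing given by a positive marker joins the two regions swept out when the over-strand is rotated counterclockwise towards the under-strand (Kauffman's $A$-smoothing); a negative marker gives the other smoothing. $D_s$ is the system of circles obtained by smoothing all crossings according to $s$, $|s|$ is the number of circles of $D_s$, and $\sigma(s)$ is the number of positive markers minus the number of negative markers. $s_+$ (resp. $s_-$) is the state with all markers positive (resp. negative). An enhanced state $S$ is a Kauffman state $s$ with a sign $+$ or $-$ assigned to each circle of $D_s$; $D_S=D_s$, $\sigma(S)=\sigma(s)$, and $\tau(S)$ is the number of positive circles minus the number of negative circles. $\mathcal{C}_{i,j}(D)$ is the free abelian group on the enhanced states $S$ with $\sigma(S)=i$ and $\sigma(S)+2\tau(S)=j$. After ordering the crossings, $d_{i,j}:\mathcal{C}_{i,j}(D)\to\mathcal{C}_{i-2,j}(D)$ is $d(S)=\sum_{S'}(-1)^{t(S:S')}[S:S']S'$, summed over enhanced states $S'$ generating $\mathcal{C}_{i-2,j}(D)$, where $[S:S']=1$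 if the markers of $S$ and $S'$ differ at exactly one crossing $c$ and all circles of $D_S$ and $D_{S'}$ not touching $c$ have the same signs in $S$ and $S'$, and $[S:S']=0$ otherwise; $t(S:S')$ is the number of negative markers of $S$ at crossings bigger than $c$. $H_{i,j}(D)=\ker(d_{i,j})/d_{i+2,j}(\mathcal{C}_{i+2,j}(D))$. Graphs. For a Kauffman state $s$, $G_s(D)$ is the graph whose vertices are the circles of $D_s$ and whose edges are in bijection with the crossings of $D$, the edge of a crossing connecting the circle(s) of $D_s$ touching at that crossing. A 2-gon is a cycle of length 2 (two distinct edges with the same two distinct endpoints). An edge is singular if it is not part of a 2-gon. *)

theory Defs
  imports "HOL-Algebra.Free_Abelian_Groups" "HOL-Algebra.Elementary_Groups" "HOL-Library.FuncSet"
begin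

section \<open>Link diagrams\<close>

text \<open>
  A diagram of an unoriented framed link is encoded by a planar diagram code.  The crossings are
  the numbers \<open>0, \<dots>, num_crossings D - 1\<close>, so they come with an ordering (every ordering of the
  crossings of a diagram arises from some labelling).  Around a crossing \<open>c\<close> there are four ends
  of arcs, numbered \<open>0, 1, 2, 3\<close> counterclockwise in such a way that \<open>0\<close> and \<open>2\<close> belong to the
  under-strand and \<open>1\<close> and \<open>3\<close> to the over-strand; \<open>arc_at D c k\<close> is the arc whose end is at
  position \<open>k\<close>.  An arc that meets no crossing is a closed component without crossings.
\<close>

record 'a diagram =
  num_crossings :: nat
  arcs :: "'a set"
  arc_at :: "nat \<Rightarrow> nat \<Rightarrow> 'a"

definition classes_of :: "'b set \<Rightarrow> ('b \<Rightarrow> 'b \<Rightarrow> bool) \<Rightarrow> 'b set set" where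
  "classes_of A r = A // {(x, y). equivclp r x y}"

definition arc_ends :: "'a diagram \<Rightarrow> (nat \<times> nat) set" where
  "arc_ends D = {..<num_crossings D} \<times> {..<4}"

definition pd_code :: "'a diagram \<Rightarrow> bool" where
  "pd_code D \<longleftrightarrow>
     finite (arcs D) \<and>
     (\<forall>(c, k) \<in> arc_ends D. arc_at D c k \<in> arcs D) \<and>
     (\<forall>a \<in> arcs D. card {(c, k) \<in> arc_ends D. arc_at D c k = a} \<in> {0, 2})"

text \<open>
  The pair \<open>(c, k)\<close> also names the corner at \<open>c\<close> between the positions \<open>k\<close> and \<open>k + 1\<close> (mod 4).
  Following the boundary of the region containing this corner along the arc at position \<open>k + 1\<close>
  leads to the corner numbered by the other end of that arc.
\<close>

definition next_corner :: "'a diagram \<Rightarrow> nat \<times> nat \<Rightarrow> nat \<times> nat \<Rightarrow> bool" where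
  "next_corner D p q \<longleftrightarrow>
     (case (p, q) of ((c, k), (c', k')) \<Rightarrow>
        (c, k) \<in> arc_ends D \<and> (c', k') \<in> arc_ends D \<and>
        (c', k') \<noteq> (c, (k + 1) mod 4) \<and> arc_at D c' k' = arc_at D c ((k + 1) mod 4))"

definition faces :: "'a diagram \<Rightarrow> (nat \<times> nat) set set" where
  "faces D = classes_of (arc_ends D) (next_corner D)"

definition adjacent_crossings :: "'a diagram \<Rightarrow> nat \<Rightarrow> nat \<Rightarrow> bool" where
  "adjacent_crossings D c c' \<longleftrightarrow>
     (\<exists>k k'. (c, k) \<in> arc_ends D \<and> (c', k') \<in> arc_ends D \<and> arc_at D c k = arc_at D c' k')"

text \<open>
  Planarity by Euler's formula: the 4-valent graph of the crossings has \<open>V = num_crossings D\<close>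
  vertices and \<open>2 * V\<close> edges.  When the faces are traced separately for each of its \<open>K\<close> connected
  components, \<open>V - 2 * V + F = 2 * K - 2 * g\<close> with \<open>g\<close> the sum of the genera of the components.
\<close>

definition planar :: "'a diagram \<Rightarrow> bool" where
  "planar D \<longleftrightarrow>
     card (faces D) =
       num_crossings D + 2 * card (classes_of {..<num_crossings D} (adjacent_crossings D))"

definition link_diagram :: "'a diagram \<Rightarrow> bool" where
  "link_diagram D \<longleftrightarrow> pd_code D \<and> planar D"

definition meet_at_crossing :: "'a diagram \<Rightarrow> 'a \<Rightarrow> 'a \<Rightarrow> bool" where
  "meet_at_crossing D a b \<longleftrightarrow>
     (\<exists>c k l. (c, k) \<in> arc_ends D \<and> (c, l) \<in> arc_ends D \<and> arc_at D c k = a \<and> arc_at D c l = b)"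

definition connected_diagram :: "'a diagram \<Rightarrow> bool" where
  "connected_diagram D \<longleftrightarrow> card (classes_of (arcs D) (meet_at_crossing D)) = 1"

section \<open>Kauffman states\<close>

datatype pm = Plus | Minus

definition kauffman_states :: "'a diagram \<Rightarrow> (nat \<Rightarrow> pm) set" where
  "kauffman_states D = {..<num_crossings D} \<rightarrow>\<^sub>E UNIV"

text \<open>
  Rotating the over-strand (positions 1, 3) counterclockwise sweeps out the corners between 1, 2
  and between 3, 0.  Joining these regions leaves one strand connecting the positions 0, 1 and
  one connecting 2, 3.
\<close>

fun smoothing_strands :: "pm \<Rightarrow> (nat \<times> nat) set" where
  "smoothing_strands Plus = {(0, 1), (2, 3)}"
| "smoothing_strands Minus = {(1, 2), (3, 0)}"

definition joined_by_smoothing :: "'a diagram \<Rightarrow> (nat \<Rightarrow> pm) \<Rightarrow> 'a \<Rightarrow> 'a \<Rightarrow> bool" where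
  "joined_by_smoothing D s a b \<longleftrightarrow>
     (\<exists>c < num_crossings D. \<exists>(k, l) \<in> smoothing_strands (s c).
        arc_at D c k = a \<and> arc_at D c l = b)"

text \<open>A circle of the smoothed diagram is represented by the set of the arcs it consists of.\<close>

definition circles :: "'a diagram \<Rightarrow> (nat \<Rightarrow> pm) \<Rightarrow> 'a set set" where
  "circles D s = classes_of (arcs D) (joined_by_smoothing D s)"

definition touches :: "'a diagram \<Rightarrow> 'a set \<Rightarrow> nat \<Rightarrow> bool" where
  "touches D C c \<longleftrightarrow> (\<exists>k < 4. arc_at D c k \<in> C)"

definition all_plus :: "'a diagram \<Rightarrow> nat \<Rightarrow> pm" where
  "all_plus D = (\<lambda>c \<in> {..<num_crossings D}. Plus)"

section \<open>Khovanov homology\<close>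

type_synonym 'a enhanced_state = "(nat \<Rightarrow> pm) \<times> ('a set \<Rightarrow> pm)"

definition enhanced_states :: "'a diagram \<Rightarrow> 'a enhanced_state set" where
  "enhanced_states D = (SIGMA s : kauffman_states D. circles D s \<rightarrow>\<^sub>E UNIV)"

definition sigma :: "'a diagram \<Rightarrow> 'a enhanced_state \<Rightarrow> int" where
  "sigma D S =
     int (card {c. c < num_crossings D \<and> fst S c = Plus})
     - int (card {c. c < num_crossings D \<and> fst S c = Minus})"

definition tau :: "'a diagram \<Rightarrow> 'a enhanced_state \<Rightarrow> int" where
  "tau D S =
     int (card {C \<in> circles D (fst S). snd S C = Plus})
     - int (card {C \<in> circles D (fst S). snd S C = Minus})"

definition chain_generators :: "'a diagram \<Rightarrow> int \<Rightarrow> int \<Rightarrow> 'a enhanced_state set" where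
  "chain_generators D i j = {S \<in> enhanced_states D. sigma D S = i \<and> sigma D S + 2 * tau D S = j}"

definition khovanov_chains :: "'a diagram \<Rightarrow> int \<Rightarrow> int \<Rightarrow> ('a enhanced_state \<Rightarrow>\<^sub>0 int) monoid" where
  "khovanov_chains D i j = free_Abelian_group (chain_generators D i j)"

text \<open>
  Circles not touching \<open>c\<close> are unaffected by a change of the marker at \<open>c\<close>, hence are the same
  sets of arcs for both states.
\<close>

definition differ_only_at ::
    "'a diagram \<Rightarrow> 'a enhanced_state \<Rightarrow> 'a enhanced_state \<Rightarrow> nat \<Rightarrow> bool" where
  "differ_only_at D S S' c \<longleftrightarrow>
     {c'. c' < num_crossings D \<and> fst S c' \<noteq> fst S' c'} = {c} \<and>
     (\<forall>C \<in> circles D (fst S) \<union> circles D (fst S'). \<not> touches D C c \<longrightarrow> snd S C = snd S' C)"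

definition incidence :: "'a diagram \<Rightarrow> 'a enhanced_state \<Rightarrow> 'a enhanced_state \<Rightarrow> int" where
  "incidence D S S' = (if \<exists>c. differ_only_at D S S' c then 1 else 0)"

definition sign_exponent :: "'a diagram \<Rightarrow> 'a enhanced_state \<Rightarrow> 'a enhanced_state \<Rightarrow> nat" where
  "sign_exponent D S S' =
     card {c'. c' < num_crossings D \<and> fst S c' = Minus \<and> (THE c. differ_only_at D S S' c) < c'}"

definition khovanov_d ::
    "'a diagram \<Rightarrow> int \<Rightarrow> int \<Rightarrow> ('a enhanced_state \<Rightarrow>\<^sub>0 int) \<Rightarrow> ('a enhanced_state \<Rightarrow>\<^sub>0 int)" where
  "khovanov_d D i j =
     frag_extend (\<lambda>S. \<Sum>S' \<in> chain_generators D (i - 2) j.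
       frag_cmul ((-1) ^ sign_exponent D S S' * incidence D S S') (frag_of S'))"

definition khovanov_homology ::
    "'a diagram \<Rightarrow> int \<Rightarrow> int \<Rightarrow> ('a enhanced_state \<Rightarrow>\<^sub>0 int) set monoid" where
  "khovanov_homology D i j =
     (khovanov_chains D i j)
       \<lparr>carrier := kernel (khovanov_chains D i j) (khovanov_chains D (i - 2) j) (khovanov_d D i j)\<rparr>
     Mod (khovanov_d D (i + 2) j ` carrier (khovanov_chains D (i + 2) j))"

definition has_Z2_torsion :: "('b, 'm) monoid_scheme \<Rightarrow> bool" where
  "has_Z2_torsion G \<longleftrightarrow> (\<exists>K. subgroup K G \<and> G\<lparr>carrier := K\<rparr> \<cong> integer_mod_group 2)"

section \<open>The graph of a Kauffman state\<close>

text \<open>Undirected multigraphs; \<open>ends G e\<close> is the set of the one or two endpoints of \<open>e\<close>.\<close>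

record ('v, 'e) multigraph =
  vertices :: "'v set"
  edges :: "'e set"
  ends :: "'e \<Rightarrow> 'v set"

definition state_graph :: "'a diagram \<Rightarrow> (nat \<Rightarrow> pm) \<Rightarrow> ('a set, nat) multigraph" where
  "state_graph D s =
     \<lparr>vertices = circles D s,
      edges = {..<num_crossings D},
      ends = (\<lambda>c. {C \<in> circles D s. touches D C c})\<rparr>"

definition is_loop :: "('v, 'e) multigraph \<Rightarrow> 'e \<Rightarrow> bool" where
  "is_loop G e \<longleftrightarrow> e \<in> edges G \<and> card (ends G e) = 1"

definition plus_adequate :: "'a diagram \<Rightarrow> bool" where
  "plus_adequate D \<longleftrightarrow> (\<nexists>e. is_loop (state_graph D (all_plus D)) e)"

definition is_cycle :: "('v, 'e) multigraph \<Rightarrow> nat \<Rightarrow> 'v list \<Rightarrow> 'e list \<Rightarrow> bool" where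
  "is_cycle G n vs es \<longleftrightarrow>
     n \<ge> 1 \<and> length vs = n \<and> length es = n \<and>
     distinct vs \<and> distinct es \<and> set vs \<subseteq> vertices G \<and> set es \<subseteq> edges G \<and>
     (\<forall>i < n. ends G (es ! i) = {vs ! i, vs ! ((i + 1) mod n)})"

definition singular_edge :: "('v, 'e) multigraph \<Rightarrow> 'e \<Rightarrow> bool" where
  "singular_edge G e \<longleftrightarrow>
     e \<in> edges G \<and> \<not> (\<exists>vs es. is_cycle G 2 vs es \<and> e \<in> set es)"

end

theory Submission
  imports Defs
begin

text \<open>
  In the second grading \<open>j\<close> of the theorem, a generator with few negative markers has few negative
  circles: two of them if all markers are positive; one if exactly one marker, at \<open>e\<close>, is negative
  (the two circles touching at \<open>e\<close> have merged, lemma \<open>circles_merge\<close>); and none if the markers at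
  two crossings \<open>e\<close>, \<open>f\<close> are negative whose edges in the graph of the positive state are not
  parallel.  Fix the singular edge \<open>e\<close> and keep its marker negative.  The generators just described
  are then the vertices and the edges \<open>f\<close> of the graph contracted along \<open>e\<close>, and the differential
  sends a vertex to the sum, up to a sign that depends on \<open>e\<close> and \<open>f\<close> only, of the edges at it.
  Since \<open>e\<close> is singular, the contracted graph has no loops, so the sum \<open>y\<close> of all vertices has
  boundary \<open>2 x\<close>, where \<open>x\<close> is the signed sum of all edges.

  The chain \<open>x\<close> is a cycle: a generator with three negative markers that its boundary could involve
  has positive circles only, and if its negative markers are at \<open>e\<close>, \<open>f\<close>, \<open>g\<close>, it is reached once from
  \<open>{e, f}\<close> and once from \<open>{e, g}\<close>, with opposite signs.

  It is not a boundary, and here the even cycle \<open>F\<close> comes in.  Contracting \<open>e\<close> makes it an odd cycle,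
  whose vertices cannot be labelled by integers such that the labels at the ends of every edge have
  an odd sum.  So \<open>x\<close> is not the boundary of a combination of vertices.  To deal with the generators
  whose negative marker is not at \<open>e\<close> as well, consider the sum modulo 2 of the
  coefficients at all pairs of edges of \<open>F\<close>.  It vanishes on every boundary, because \<open>F\<close> has even
  degrees, also after the contraction of any of its edges (\<open>even_degree_after_contraction\<close>), but it
  is 1 on \<open>x\<close>, which involves the \<open>card F - 1\<close> pairs through \<open>e\<close> (\<open>edge_sum_not_boundary\<close>).

  So the class of \<open>x\<close> has order two.
\<close>

section \<open>Circles of Kauffman states\<close>

definition circle_of :: "'a diagram \<Rightarrow> (nat \<Rightarrow> pm) \<Rightarrow> 'a \<Rightarrow> 'a set" where
  "circle_of D s a = {b. equivclp (joined_by_smoothing D s) a b}"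

lemma circles_eq_image: "circles D s = circle_of D s ` arcs D"
  by (auto simp: circles_def classes_of_def quotient_def circle_of_def)

lemma mem_circle_of_self: "a \<in> circle_of D s a"
  by (simp add: circle_of_def)

lemma circle_of_eq_iff:
  "circle_of D s a = circle_of D s b \<longleftrightarrow> equivclp (joined_by_smoothing D s) a b"
proof
  assume "circle_of D s a = circle_of D s b"
  then have "b \<in> circle_of D s a" by (simp add: mem_circle_of_self)
  then show "equivclp (joined_by_smoothing D s) a b" by (simp add: circle_of_def)
next
  assume ab: "equivclp (joined_by_smoothing D s) a b"
  show "circle_of D s a = circle_of D s b"
    unfolding circle_of_def by (auto intro: equivclp_trans[OF ab] equivclp_trans[OF equivclp_sym[OF ab]])
qed

lemma circle_of_eq_if_mem: "b \<in> circle_of D s a \<Longrightarrow> circle_of D s b = circle_of D s a"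
  by (metis (mono_tags) circle_of_def circle_of_eq_iff mem_Collect_eq)

lemma circle_of_eq_if_joined:
  assumes "joined_by_smoothing D s a b"
  shows "circle_of D s a = circle_of D s b"
  using assms by (auto simp: circle_of_eq_iff)

lemma mem_circle_of_joined_iff:
  assumes "joined_by_smoothing D s x y"
  shows "x \<in> circle_of D s z \<longleftrightarrow> y \<in> circle_of D s z"
  by (metis circle_of_eq_if_joined[OF assms] circle_of_eq_if_mem mem_circle_of_self)

lemma joined_by_strand:
  assumes "c < num_crossings D" "(k, l) \<in> smoothing_strands (s c)"
  shows "joined_by_smoothing D s (arc_at D c k) (arc_at D c l)"
  using assms by (auto simp: joined_by_smoothing_def)

text \<open>
  A set of arcs is a union of circles as soon as it is respected by all joins; this is how
  inclusions between circles of different states are obtained.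
\<close>

lemma circle_of_subset:
  assumes a: "a \<in> K"
    and closed: "\<And>x y. joined_by_smoothing D s x y \<Longrightarrow> x \<in> K \<longleftrightarrow> y \<in> K"
  shows "circle_of D s a \<subseteq> K"
proof
  fix b assume "b \<in> circle_of D s a"
  then have "equivclp (joined_by_smoothing D s) a b" by (simp add: circle_of_def)
  then show "b \<in> K"
    by (induction rule: equivclp_induct) (use a closed in auto)
qed

lemma card_ends_at_crossing:
  "card {k. k < 4 \<and> P k} = of_bool (P 0) + of_bool (P 1) + of_bool (P 2) + of_bool (P (3::nat))"
proof -
  have "card {k. k < 4 \<and> P k} = (\<Sum>k<4. of_bool (P k))"
    by (simp add: of_bool_def sum.If_cases Int_def)
  then show ?thesis
    by (simp add: eval_nat_numeral)
qed

context
  fixes D :: "'a diagram"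
  assumes pd: "pd_code D"
begin

lemma arc_at_mem_arcs: "c < num_crossings D \<Longrightarrow> k < 4 \<Longrightarrow> arc_at D c k \<in> arcs D"
  using pd by (force simp: pd_code_def arc_ends_def)

lemma finite_circles: "finite (circles D s)"
  using pd by (simp add: circles_eq_image pd_code_def)

lemma circle_of_mem_circles:
  "c < num_crossings D \<Longrightarrow> k < 4 \<Longrightarrow> circle_of D s (arc_at D c k) \<in> circles D s"
  by (simp add: circles_eq_image arc_at_mem_arcs)

text \<open>
  The arcs of \<open>K\<close> have an even number of ends altogether, and every smoothing strand away from
  \<open>c\<close> accounts for two of them or none.  This is how the condition that arcs have two ends enters.
\<close>

lemma even_ends_at_crossing:
  assumes c: "c < num_crossings D"
    and closed: "\<And>c' k l. c' < num_crossings D \<Longrightarrow> c' \<noteq> c \<Longrightarrow> (k, l) \<in> smoothing_strands (s c') \<Longrightarrow>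
                  arc_at D c' k \<in> K \<longleftrightarrow> arc_at D c' l \<in> K"
  shows "even (card {k. k < 4 \<and> arc_at D c k \<in> K})"
proof -
  let ?E = "\<lambda>c'. {k. k < 4 \<and> arc_at D c' k \<in> K}"
  let ?A = "\<lambda>a. {(c, k). (c, k) \<in> arc_ends D \<and> arc_at D c k = a}"
  have fin: "finite (arc_ends D)" by (simp add: arc_ends_def)
  have 1: "(SIGMA c':{..<num_crossings D}. ?E c') = (\<Union>a\<in>K \<inter> arcs D. ?A a)"
    by (auto simp: arc_ends_def arc_at_mem_arcs)
  have "card (\<Union>a\<in>K \<inter> arcs D. ?A a) = (\<Sum>a\<in>K \<inter> arcs D. card (?A a))"
    by (rule card_UN_disjoint)
      (use pd fin in \<open>auto simp: pd_code_def intro: finite_subset[OF _ fin]\<close>)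
  moreover have "even (card (?A a))" if "a \<in> arcs D" for a
    using pd that by (fastforce simp: pd_code_def)
  ultimately have "even (card (SIGMA c':{..<num_crossings D}. ?E c'))"
    unfolding 1 by (auto intro!: dvd_sum)
  then have "even (\<Sum>c'<num_crossings D. card (?E c'))"
    by (subst (asm) card_SigmaI) auto
  also have "(\<Sum>c'<num_crossings D. card (?E c')) =
      card (?E c) + (\<Sum>c'\<in>{..<num_crossings D} - {c}. card (?E c'))"
    using c by (subst sum.remove[of _ c]) auto
  finally have *: "even (card (?E c) + (\<Sum>c'\<in>{..<num_crossings D} - {c}. card (?E c')))" .
  have "even (card (?E c'))" if "c' \<in> {..<num_crossings D} - {c}" for c'
  proof (cases "s c'")
    case Plus
    then have "arc_at D c' 0 \<in> K \<longleftrightarrow> arc_at D c' 1 \<in> K" "arc_at D c' 2 \<in> K \<longleftrightarrow> arc_at D c' 3 \<in> K"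
      using closed[of c'] that by auto
    then show ?thesis by (subst card_ends_at_crossing) auto
  next
    case Minus
    then have "arc_at D c' 1 \<in> K \<longleftrightarrow> arc_at D c' 2 \<in> K" "arc_at D c' 3 \<in> K \<longleftrightarrow> arc_at D c' 0 \<in> K"
      using closed[of c'] that by auto
    then show ?thesis by (subst card_ends_at_crossing) auto
  qed
  then have "even (\<Sum>c'\<in>{..<num_crossings D} - {c}. card (?E c'))" by (auto intro!: dvd_sum)
  with * show ?thesis by simp
qed

lemma joined_at_crossing:
  assumes "c < num_crossings D"
  shows "s c = Plus \<Longrightarrow> joined_by_smoothing D s (arc_at D c 0) (arc_at D c 1)"
    and "s c = Plus \<Longrightarrow> joined_by_smoothing D s (arc_at D c 2) (arc_at D c 3)"
    and "s c = Minus \<Longrightarrow> joined_by_smoothing D s (arc_at D c 1) (arc_at D c 2)"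
    and "s c = Minus \<Longrightarrow> joined_by_smoothing D s (arc_at D c 3) (arc_at D c 0)"
  using assms by (force simp: joined_by_smoothing_def)+

lemma touching_circles:
  assumes "c < num_crossings D"
  shows "{C \<in> circles D s. touches D C c} = {circle_of D s (arc_at D c 0), circle_of D s (arc_at D c 2)}"
proof -
  have "circle_of D s (arc_at D c k) \<in> {circle_of D s (arc_at D c 0), circle_of D s (arc_at D c 2)}"
    if "k < 4" for k
  proof -
    have "k = 0 \<or> k = 1 \<or> k = 2 \<or> k = 3" using that by auto
    then show ?thesis
      using joined_at_crossing[OF assms, THEN circle_of_eq_if_joined, of s]
      by (cases "s c") auto
  qed
  moreover have "C = circle_of D s (arc_at D c k)"
    if "C \<in> circles D s" "arc_at D c k \<in> C" for C k
    using that by (auto simp: circles_eq_image circle_of_eq_if_mem)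
  ultimately have "{C \<in> circles D s. touches D C c}
      \<subseteq> {circle_of D s (arc_at D c 0), circle_of D s (arc_at D c 2)}"
    by (auto simp: touches_def)
  moreover have "touches D (circle_of D s (arc_at D c k)) c" if "k < 4" for k
    using that mem_circle_of_self by (fastforce simp: touches_def)
  ultimately show ?thesis
    using circle_of_mem_circles[OF assms] by auto
qed

lemma circle_of_eq_if_untouched:
  assumes same: "\<And>c'. c' < num_crossings D \<Longrightarrow> c' \<noteq> c \<Longrightarrow> s c' = s' c'"
    and "\<not> touches D (circle_of D s x) c"
  shows "circle_of D s' x = circle_of D s x"
proof -
  have sub: "circle_of D s2 x \<subseteq> circle_of D s1 x"
    if same: "\<And>c'. c' < num_crossings D \<Longrightarrow> c' \<noteq> c \<Longrightarrow> s1 c' = s2 c'"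
      and untouched: "\<not> touches D (circle_of D s1 x) c" for s1 s2
  proof (rule circle_of_subset)
    fix y z assume j: "joined_by_smoothing D s2 y z"
    then obtain c' k l where c': "c' < num_crossings D" "(k, l) \<in> smoothing_strands (s2 c')"
      "y = arc_at D c' k" "z = arc_at D c' l"
      by (auto simp: joined_by_smoothing_def)
    have kl: "k < 4" "l < 4" using c'(2) by (cases "s2 c'"; auto)+
    show "y \<in> circle_of D s1 x \<longleftrightarrow> z \<in> circle_of D s1 x"
    proof (cases "c' = c")
      case True
      then show ?thesis using untouched c' kl by (auto simp: touches_def)
    next
      case False
      then have "joined_by_smoothing D s1 y z"
        using c' same[of c'] by (force simp: joined_by_smoothing_def)
      then show ?thesis by (rule mem_circle_of_joined_iff)
    qed
  qed (simp add: mem_circle_of_self)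
  have 1: "circle_of D s' x \<subseteq> circle_of D s x"
    by (rule sub) (use assms in auto)
  then have "\<not> touches D (circle_of D s' x) c"
    using assms(2) by (auto simp: touches_def)
  then have "circle_of D s x \<subseteq> circle_of D s' x"
    using same by (intro sub) auto
  with 1 show ?thesis by simp
qed

lemma untouched_circles_eq:
  assumes "\<And>c'. c' < num_crossings D \<Longrightarrow> c' \<noteq> c \<Longrightarrow> s c' = s' c'"
  shows "{C \<in> circles D s. \<not> touches D C c} = {C \<in> circles D s'. \<not> touches D C c}"
proof -
  have "{C \<in> circles D s1. \<not> touches D C c} \<subseteq> {C \<in> circles D s2. \<not> touches D C c}"
    if "\<And>c'. c' < num_crossings D \<Longrightarrow> c' \<noteq> c \<Longrightarrow> s1 c' = s2 c'" for s1 s2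
    using circle_of_eq_if_untouched[of c s1 s2] that by (fastforce simp: circles_eq_image)
  from this[of s s'] this[of s' s] assms show ?thesis by auto
qed

text \<open>
  The circles away from \<open>c\<close> persist, and one or two circles touch \<open>c\<close> before and after the
  change.
\<close>

lemma card_circles_change_marker:
  assumes c: "c < num_crossings D"
    and same: "\<And>c'. c' < num_crossings D \<Longrightarrow> c' \<noteq> c \<Longrightarrow> s c' = s' c'"
  shows "card (circles D s') \<le> card (circles D s) + 1"
proof -
  have split: "card (circles D t) =
      card {C \<in> circles D t. \<not> touches D C c} + card {C \<in> circles D t. touches D C c}" for t
  proof -
    have "circles D t = {C \<in> circles D t. \<not> touches D C c} \<union> {C \<in> circles D t. touches D C c}"
      by auto
    then show ?thesis
      by (subst (1)  \<open>circles D t = _\<close>, subst card_Un_disjoint) (auto simp: finite_circles)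
  qed
  have "1 \<le> card {C \<in> circles D s. touches D C c}" "card {C \<in> circles D s'. touches D C c} \<le> 2"
    by (auto simp: touching_circles[OF c] card_insert_if)
  moreover have "{C \<in> circles D s. \<not> touches D C c} = {C \<in> circles D s'. \<not> touches D C c}"
    using same by (rule untouched_circles_eq)
  ultimately show ?thesis
    using split[of s] split[of s'] by simp
qed

text \<open>
  When the crossing is cut out, the first circle still connects the arcs at the positions \<open>0\<close> and
  \<open>1\<close>: otherwise the part containing position \<open>0\<close> would have a single end at \<open>c\<close>, against parity.
  The negative smoothing adds the joins \<open>1\<close> to \<open>2\<close> and \<open>3\<close> to \<open>0\<close>, so all four positions lie on
  one circle, and these joins do not lead out of the union of the two old circles.
\<close>

lemma circle_of_merge:
  assumes c: "c < num_crossings D"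
    and plus: "s c = Plus" and minus: "s' c = Minus"
    and same: "\<And>c'. c' < num_crossings D \<Longrightarrow> c' \<noteq> c \<Longrightarrow> s c' = s' c'"
    and A: "A = circle_of D s (arc_at D c 0)" and B: "B = circle_of D s (arc_at D c 2)"
    and AB: "A \<noteq> B"
  shows "circle_of D s' x = (if x \<in> A \<union> B then A \<union> B else circle_of D s x)"
proof -
  have disj: "A \<inter> B = {}"
    using AB A B by (metis circle_of_eq_if_mem disjoint_iff)
  have A01: "arc_at D c 0 \<in> A" "arc_at D c 1 \<in> A" and B23: "arc_at D c 2 \<in> B" "arc_at D c 3 \<in> B"
    using A B joined_at_crossing(1,2)[of c s, OF c plus, THEN circle_of_eq_if_joined]
    by (metis mem_circle_of_self)+
  have closed: "arc_at D c' k \<in> circle_of D t y \<longleftrightarrow> arc_at D c' l \<in> circle_of D t y"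
    if "c' < num_crossings D" "(k, l) \<in> smoothing_strands (t c')" for t c' k l y
    using joined_by_strand[of c' D k l t, OF that] by (rule mem_circle_of_joined_iff)
  have pos: "circle_of D s' (arc_at D c 0) = circle_of D s' (arc_at D c 3)"
    "circle_of D s' (arc_at D c 1) = circle_of D s' (arc_at D c 2)"
    using joined_at_crossing(3,4)[of c s', OF c minus] circle_of_eq_if_joined by metis+
  have join: "circle_of D s' (arc_at D c 0) = circle_of D s' (arc_at D c 1)"
  proof -
    \<comment> \<open>Intersecting with \<open>A\<close> removes the positions 2 and 3, so that position 1 must make up the parity.\<close>
    let ?K = "circle_of D s' (arc_at D c 0) \<inter> A"
    have "even (card {k. k < 4 \<and> arc_at D c k \<in> ?K})"
      using closed[where t = s] closed[where t = s'] A same by (intro even_ends_at_crossing[OF c, of s]) auto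
    moreover have "arc_at D c 0 \<in> ?K" "arc_at D c 2 \<notin> ?K" "arc_at D c 3 \<notin> ?K"
      using A01 B23 disj by (auto simp: mem_circle_of_self)
    ultimately have "arc_at D c 1 \<in> ?K"
      by (subst (asm) card_ends_at_crossing) (auto split: if_splits)
    then show ?thesis using circle_of_eq_if_mem by fastforce
  qed
  have same_circle: "circle_of D s' y = circle_of D s' z" if yz: "joined_by_smoothing D s y z" for y z
  proof -
    obtain c' k l where c': "c' < num_crossings D" "(k, l) \<in> smoothing_strands (s c')"
      "y = arc_at D c' k" "z = arc_at D c' l"
      using yz by (auto simp: joined_by_smoothing_def)
    show ?thesis
    proof (cases "c' = c")
      case True
      then have "(k = 0 \<and> l = 1) \<or> (k = 2 \<and> l = 3)" using c' plus by auto
      then show ?thesis using c' True join pos by auto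
    next
      case False
      then have "joined_by_smoothing D s' y z"
        using c' same by (auto simp: joined_by_smoothing_def)
      then show ?thesis by (rule circle_of_eq_if_joined)
    qed
  qed
  have sub: "circle_of D s y \<subseteq> circle_of D s' y" for y
  proof (rule circle_of_subset)
    show "u \<in> circle_of D s' y \<longleftrightarrow> v \<in> circle_of D s' y" if "joined_by_smoothing D s u v" for u v
      by (metis same_circle[OF that] circle_of_eq_if_mem mem_circle_of_self)
  qed (simp add: mem_circle_of_self)
  let ?M = "circle_of D s' (arc_at D c 0)"
  have "A \<union> B \<subseteq> ?M"
    using sub[of "arc_at D c 0"] sub[of "arc_at D c 2"] A B join pos by auto
  moreover have "?M \<subseteq> A \<union> B"
  proof (rule circle_of_subset)
    fix u v assume "joined_by_smoothing D s' u v"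
    then obtain c' k l where c': "c' < num_crossings D" "(k, l) \<in> smoothing_strands (s' c')"
      "u = arc_at D c' k" "v = arc_at D c' l"
      by (auto simp: joined_by_smoothing_def)
    show "u \<in> A \<union> B \<longleftrightarrow> v \<in> A \<union> B"
    proof (cases "c' = c")
      case True
      then show ?thesis using c' minus A01 B23 by auto
    next
      case False
      then show ?thesis using c' same closed[where t = s] A B by auto
    qed
  qed (simp add: A01)
  ultimately have M: "?M = A \<union> B" by (rule subset_antisym[rotated])
  show ?thesis
  proof (cases "x \<in> A \<union> B")
    case True
    then show ?thesis using M circle_of_eq_if_mem[of x D s' "arc_at D c 0"] by simp
  next
    case False
    have "\<not> touches D (circle_of D s x) c"
    proof
      assume "touches D (circle_of D s x) c"
      then obtain k where k: "k < 4" "arc_at D c k \<in> circle_of D s x" by (auto simp: touches_def)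
      then have "circle_of D s x = circle_of D s (arc_at D c k)"
        using circle_of_eq_if_mem by fastforce
      moreover have "k = 0 \<or> k = 1 \<or> k = 2 \<or> k = 3" using k by auto
      then have "arc_at D c k \<in> A \<union> B" using A01 B23 by auto
      then have "circle_of D s (arc_at D c k) \<in> {A, B}"
        using A B circle_of_eq_if_mem by fastforce
      ultimately show False using False mem_circle_of_self[of x D s] by auto
    qed
    then have "circle_of D s' x = circle_of D s x"
      using same by (intro circle_of_eq_if_untouched)
    then show ?thesis using False by simp
  qed
qed

lemma circles_merge:
  assumes c: "c < num_crossings D"
    and plus: "s c = Plus" and minus: "s' c = Minus"
    and same: "\<And>c'. c' < num_crossings D \<Longrightarrow> c' \<noteq> c \<Longrightarrow> s c' = s' c'"
    and A: "A = circle_of D s (arc_at D c 0)" and B: "B = circle_of D s (arc_at D c 2)"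
    and AB: "A \<noteq> B"
  shows "circles D s' = insert (A \<union> B) (circles D s - {A, B})"
    and "card (circles D s') = card (circles D s) - 1"
proof -
  note merge = circle_of_merge[OF assms(1-3) same A B AB]
  have mem: "x \<in> A \<union> B \<longleftrightarrow> circle_of D s x \<in> {A, B}" for x
    using A B circle_of_eq_if_mem mem_circle_of_self by fastforce
  have in_circles: "A \<in> circles D s" "B \<in> circles D s"
    using A B c circle_of_mem_circles by auto
  have a0: "arc_at D c 0 \<in> arcs D" "arc_at D c 0 \<in> A"
    using arc_at_mem_arcs c A mem_circle_of_self by auto
  show 1: "circles D s' = insert (A \<union> B) (circles D s - {A, B})"
  proof (intro equalityI subsetI)
    fix C assume "C \<in> circles D s'"
    then show "C \<in> insert (A \<union> B) (circles D s - {A, B})"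
      using mem by (auto simp: circles_eq_image merge)
  next
    fix C assume C: "C \<in> insert (A \<union> B) (circles D s - {A, B})"
    show "C \<in> circles D s'"
    proof (cases "C = A \<union> B")
      case True
      then show ?thesis using a0 merge by (force simp: circles_eq_image)
    next
      case False
      then obtain x where "x \<in> arcs D" "C = circle_of D s x" "C \<notin> {A, B}"
        using C by (auto simp: circles_eq_image)
      then have "C = circle_of D s' x" using mem merge by auto
      then show ?thesis using \<open>x \<in> arcs D\<close> by (simp add: circles_eq_image)
    qed
  qed
  have "A \<union> B \<notin> circles D s - {A, B}"
  proof
    assume *: "A \<union> B \<in> circles D s - {A, B}"
    then obtain x where "A \<union> B = circle_of D s x" by (auto simp: circles_eq_image)
    moreover from this have "circle_of D s x = A"
      using A a0 circle_of_eq_if_mem by (metis UnI1)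
    ultimately show False using * by auto
  qed
  moreover have "card {A, B} = 2" "2 \<le> card (circles D s)"
    using AB in_circles finite_circles card_mono[of "circles D s" "{A, B}"] by auto
  ultimately show "card (circles D s') = card (circles D s) - 1"
    unfolding 1 using in_circles finite_circles by (simp add: card_Diff_subset)
qed

end

section \<open>Generators with few negative circles\<close>

definition marked_state :: "'a diagram \<Rightarrow> nat set \<Rightarrow> nat \<Rightarrow> pm" where
  "marked_state D M = (\<lambda>c \<in> {..<num_crossings D}. if c \<in> M then Minus else Plus)"

definition positive_generator :: "'a diagram \<Rightarrow> nat set \<Rightarrow> 'a enhanced_state" where
  "positive_generator D M =
     (marked_state D M, \<lambda>C \<in> circles D (marked_state D M). Plus)"

definition one_negative_generator :: "'a diagram \<Rightarrow> nat set \<Rightarrow> 'a set \<Rightarrow> 'a enhanced_state" where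
  "one_negative_generator D M C =
     (marked_state D M, \<lambda>C' \<in> circles D (marked_state D M). if C' = C then Minus else Plus)"

definition negative_circles :: "'a diagram \<Rightarrow> 'a enhanced_state \<Rightarrow> 'a set set" where
  "negative_circles D S = {C \<in> circles D (fst S). snd S C = Minus}"

lemma marked_state_simps [simp]:
  "c < num_crossings D \<Longrightarrow> marked_state D M c = (if c \<in> M then Minus else Plus)"
  by (simp add: marked_state_def)

lemma fst_generators [simp]:
  "fst (positive_generator D M) = marked_state D M"
  "fst (one_negative_generator D M C) = marked_state D M"
  by (simp_all add: positive_generator_def one_negative_generator_def)

lemma all_plus_eq_marked_state: "all_plus D = marked_state D {}"
  by (auto simp: all_plus_def marked_state_def)

lemma not_Plus_iff: "x \<noteq> Plus \<longleftrightarrow> x = Minus"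
  by (cases x) auto

lemma not_Minus_iff: "x \<noteq> Minus \<longleftrightarrow> x = Plus"
  by (cases x) auto

lemma marked_state_in_kauffman_states: "marked_state D M \<in> kauffman_states D"
  by (auto simp: kauffman_states_def marked_state_def)

lemma kauffman_state_marked:
  assumes "s \<in> kauffman_states D"
  obtains M where "M \<subseteq> {..<num_crossings D}" "s = marked_state D M"
proof
  let ?M = "{c. c < num_crossings D \<and> s c = Minus}"
  show "s = marked_state D ?M"
    using assms by (intro ext) (auto simp: kauffman_states_def marked_state_def not_Minus_iff
        PiE_def extensional_def)
qed auto

lemma positive_generator_eq_iff:
  assumes "M \<subseteq> {..<num_crossings D}" "M' \<subseteq> {..<num_crossings D}"
  shows "positive_generator D M = positive_generator D M' \<longleftrightarrow> M = M'"
proof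
  assume "positive_generator D M = positive_generator D M'"
  then have eq: "marked_state D M = marked_state D M'"
    by (metis fst_generators(1))
  have "c \<in> M \<longleftrightarrow> c \<in> M'" if "c < num_crossings D" for c
    using fun_cong[OF eq, of c] that by (simp split: if_splits)
  then show "M = M'" using assms by blast
qed simp

lemma sigma_eq:
  assumes "M \<subseteq> {..<num_crossings D}" "fst S = marked_state D M"
  shows "sigma D S = int (num_crossings D) - 2 * int (card M)"
proof -
  have "{c. c < num_crossings D \<and> fst S c = Plus} = {..<num_crossings D} - M"
    "{c. c < num_crossings D \<and> fst S c = Minus} = M"
    using assms by (auto split: if_splits)
  moreover have "card ({..<num_crossings D} - M) = num_crossings D - card M"
    using assms by (subst card_Diff_subset) (auto intro: finite_subset)
  moreover have "card M \<le> num_crossings D"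
    using card_mono[of "{..<num_crossings D}" M] assms by simp
  ultimately show ?thesis by (simp add: sigma_def)
qed

context
  fixes D :: "'a diagram"
  assumes pd: "pd_code D"
begin

lemma tau_eq:
  "tau D S = int (card (circles D (fst S))) - 2 * int (card (negative_circles D S))"
proof -
  have "card (circles D (fst S)) =
      card ({C \<in> circles D (fst S). snd S C = Plus} \<union> negative_circles D S)"
    by (rule arg_cong[of _ _ card]) (auto simp: negative_circles_def not_Minus_iff)
  also have "\<dots> = card {C \<in> circles D (fst S). snd S C = Plus} + card (negative_circles D S)"
    using finite_circles[OF pd] by (intro card_Un_disjoint) (auto simp: negative_circles_def)
  finally show ?thesis by (simp add: tau_def negative_circles_def)
qed

lemma finite_negative_circles: "finite (negative_circles D S)"
  using finite_circles[OF pd] by (simp add: negative_circles_def)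

lemma negative_circles_generators:
  "negative_circles D (positive_generator D M) = {}"
  "C \<in> circles D (marked_state D M) \<Longrightarrow> negative_circles D (one_negative_generator D M C) = {C}"
  by (auto simp: negative_circles_def positive_generator_def one_negative_generator_def
      split: if_splits)

lemma generators_enhanced:
  "positive_generator D M \<in> enhanced_states D"
  "one_negative_generator D M C \<in> enhanced_states D"
  by (auto simp: enhanced_states_def positive_generator_def one_negative_generator_def
      marked_state_in_kauffman_states)

lemma positive_generator_unique:
  assumes "S \<in> enhanced_states D" "fst S = marked_state D M" "negative_circles D S = {}"
  shows "S = positive_generator D M"
proof (rule prod_eqI)
  have "snd S \<in> circles D (marked_state D M) \<rightarrow>\<^sub>E UNIV"
    using assms(1,2) by (auto simp: enhanced_states_def)
  moreover have "C \<in> circles D (marked_state D M) \<Longrightarrow> snd S C = Plus" for C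
    using assms(2,3) by (auto simp: negative_circles_def not_Minus_iff)
  ultimately show "snd S = snd (positive_generator D M)"
    by (auto simp: positive_generator_def fun_eq_iff PiE_def extensional_def)
qed (simp add: assms)

lemma one_negative_generator_unique:
  assumes "S \<in> enhanced_states D" "fst S = marked_state D M" "negative_circles D S = {C}"
  shows "S = one_negative_generator D M C"
proof (rule prod_eqI)
  show "snd S = snd (one_negative_generator D M C)"
  proof
    fix C'
    have "C' \<in> circles D (marked_state D M) \<Longrightarrow> snd S C' = Minus \<longleftrightarrow> C' = C"
      using assms(2,3) by (auto simp: negative_circles_def set_eq_iff)
    then show "snd S C' = snd (one_negative_generator D M C) C'"
      using assms(1,2)
      by (cases "snd S C'") (auto simp: enhanced_states_def one_negative_generator_def
        PiE_def extensional_def)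
  qed
qed (simp add: assms)

lemma finite_chain_generators: "finite (chain_generators D i j)"
proof -
  have "finite (UNIV :: pm set)"
    by (rule finite_subset[of _ "{Plus, Minus}"]) (auto simp: not_Plus_iff)
  then have "finite (enhanced_states D)"
    unfolding enhanced_states_def kauffman_states_def
    by (intro finite_SigmaI finite_PiE) (auto simp: finite_circles[OF pd])
  then show ?thesis by (simp add: chain_generators_def)
qed

text \<open>
  The gradings are parametrised so that \<open>k\<close> is the number of negative markers and \<open>k + j\<close> is the
  value of \<open>tau\<close>; given the markers, the number of negative circles is then determined by the
  number of all circles.
\<close>

lemma mem_chain_generators_iff:
  assumes "M \<subseteq> {..<num_crossings D}" "fst S = marked_state D M" "card M = m"
  shows "S \<in> chain_generators D (int (num_crossings D) - 2 * int k)
            (int (num_crossings D) + 2 * j) \<longleftrightarrow>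
         S \<in> enhanced_states D \<and> m = k \<and>
         int (card (circles D (marked_state D M))) = int k + j + 2 * int (card (negative_circles D S))"
  using sigma_eq[OF assms(1,2)] tau_eq[of S] assms(2,3)
  by (auto simp: chain_generators_def)

lemma chain_generatorE:
  assumes "S \<in> chain_generators D (int (num_crossings D) - 2 * int k) (int (num_crossings D) + 2 * j)"
  obtains M where "M \<subseteq> {..<num_crossings D}" "card M = k" "fst S = marked_state D M"
    "S \<in> enhanced_states D"
    "int (card (circles D (marked_state D M))) = int k + j + 2 * int (card (negative_circles D S))"
proof -
  have S: "S \<in> enhanced_states D" using assms by (simp add: chain_generators_def)
  then have "fst S \<in> kauffman_states D" by (auto simp: enhanced_states_def)
  then obtain M where M: "M \<subseteq> {..<num_crossings D}" "fst S = marked_state D M"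
    by (rule kauffman_state_marked)
  then show thesis
    using mem_chain_generators_iff[OF M refl, of k j] assms that by blast
qed

end

section \<open>Incidence numbers\<close>

definition coefficient :: "'a diagram \<Rightarrow> 'a enhanced_state \<Rightarrow> 'a enhanced_state \<Rightarrow> int" where
  "coefficient D S S' = (-1) ^ sign_exponent D S S' * incidence D S S'"

lemma differ_only_at_markers:
  assumes M: "M \<subseteq> {..<num_crossings D}" "fst S = marked_state D M"
    and M': "M' \<subseteq> {..<num_crossings D}" "fst S' = marked_state D M'"
    and card: "card M' = Suc (card M)"
    and diff: "differ_only_at D S S' c"
  shows "c < num_crossings D" "c \<notin> M" "M' = insert c M"
proof -
  have *: "{c'. c' < num_crossings D \<and> (c' \<in> M \<longleftrightarrow> c' \<notin> M')} = {c}"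
  proof -
    have "{c'. c' < num_crossings D \<and> fst S c' \<noteq> fst S' c'} = {c}"
      using diff by (simp add: differ_only_at_def)
    moreover have "{c'. c' < num_crossings D \<and> fst S c' \<noteq> fst S' c'} =
        {c'. c' < num_crossings D \<and> (c' \<in> M \<longleftrightarrow> c' \<notin> M')}"
      unfolding M(2) M'(2) by (auto split: if_splits)
    ultimately show ?thesis by (simp only:)
  qed
  then show c: "c < num_crossings D" by auto
  have other: "c' \<in> M \<longleftrightarrow> c' \<in> M'" if "c' \<noteq> c" for c'
    using * that M(1) M'(1) by blast
  have at: "c \<in> M \<longleftrightarrow> c \<notin> M'" using * by blast
  have fin: "finite M" using M(1) by (rule finite_subset) simp
  show "c \<notin> M"
  proof
    assume "c \<in> M"
    then have "M' \<subseteq> M" using other at by (metis subsetI)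
    then show False using card card_mono[OF fin, of M'] by simp
  qed
  then show "M' = insert c M" using other at by (metis insert_iff subset_antisym subsetI)
qed

lemma differ_only_at_insert_iff:
  assumes "M \<subseteq> {..<num_crossings D}" "fst S = marked_state D M"
    and "fst S' = marked_state D (insert c M)"
    and "c < num_crossings D" "c \<notin> M"
  shows "differ_only_at D S S' c' \<longleftrightarrow> c' = c \<and>
    (\<forall>C \<in> circles D (marked_state D M) \<union> circles D (marked_state D (insert c M)).
       \<not> touches D C c \<longrightarrow> snd S C = snd S' C)"
proof -
  have "{c'. c' < num_crossings D \<and> fst S c' \<noteq> fst S' c'} = {c}"
    using assms by (auto split: if_splits)
  then show ?thesis using assms(2,3) by (auto simp: differ_only_at_def)
qed

lemma coefficient_insert:
  assumes "M \<subseteq> {..<num_crossings D}" "fst S = marked_state D M"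
    and "fst S' = marked_state D (insert c M)"
    and "c < num_crossings D" "c \<notin> M"
  shows "coefficient D S S' =
    (if \<forall>C \<in> circles D (marked_state D M) \<union> circles D (marked_state D (insert c M)).
          \<not> touches D C c \<longrightarrow> snd S C = snd S' C
     then (-1) ^ card {c' \<in> M. c < c'} else 0)"
proof -
  have 1: "{c'. c' < num_crossings D \<and> fst S c' = Minus \<and> c < c'} = {c' \<in> M. c < c'}"
    using assms(1,2) by (auto split: if_splits)
  define Q where "Q \<longleftrightarrow> (\<forall>C \<in> circles D (marked_state D M) \<union> circles D (marked_state D (insert c M)).
          \<not> touches D C c \<longrightarrow> snd S C = snd S' C)"
  have "differ_only_at D S S' c' \<longleftrightarrow> c' = c \<and> Q" for c'
    unfolding Q_def by (rule differ_only_at_insert_iff[OF assms])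
  then show ?thesis
    unfolding Q_def[symmetric]
    by (simp add: coefficient_def incidence_def sign_exponent_def 1)
qed

lemma coefficient_nonzeroE:
  assumes M: "M \<subseteq> {..<num_crossings D}" "fst S = marked_state D M"
    and M': "M' \<subseteq> {..<num_crossings D}" "fst S' = marked_state D M'"
    and card: "card M' = Suc (card M)"
    and nz: "coefficient D S S' \<noteq> 0"
  obtains c where "c < num_crossings D" "c \<notin> M" "M' = insert c M"
proof -
  obtain c where "differ_only_at D S S' c"
    using nz by (auto simp: coefficient_def incidence_def split: if_splits)
  then show thesis using differ_only_at_markers[OF M M' card] that by blast
qed

lemma coefficient_eq_0_if_marker_lost:
  assumes "M \<subseteq> {..<num_crossings D}" "fst S = marked_state D M"
    and "M' \<subseteq> {..<num_crossings D}" "fst S' = marked_state D M'"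
    and "card M' = Suc (card M)" and "\<not> M \<subseteq> M'"
  shows "coefficient D S S' = 0"
proof (rule ccontr)
  assume "coefficient D S S' \<noteq> 0"
  with assms(1-5) obtain c where "M' = insert c M" by (rule coefficient_nonzeroE)
  with assms(6) show False by blast
qed

text \<open>
  A positive label is the nilpotent one: if all circles of the target are positive, the only
  negative circles that the source may have are those that are altered at \<open>c\<close>.
\<close>

lemma coefficient_into_positive:
  assumes "pd_code D"
    and "M \<subseteq> {..<num_crossings D}" "fst S = marked_state D M" "c < num_crossings D" "c \<notin> M"
  shows "coefficient D S (positive_generator D (insert c M)) =
    (if \<forall>C \<in> negative_circles D S. touches D C c then (-1) ^ card {c' \<in> M. c < c'} else 0)"
proof -
  have "{C \<in> circles D (marked_state D M). \<not> touches D C c} =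
      {C \<in> circles D (marked_state D (insert c M)). \<not> touches D C c}"
    using assms(1) by (intro untouched_circles_eq) auto
  then have untouched: "C \<in> circles D (marked_state D M) \<longleftrightarrow> C \<in> circles D (marked_state D (insert c M))"
    if "\<not> touches D C c" for C
    using that by auto
  have "(\<forall>C \<in> circles D (marked_state D M) \<union> circles D (marked_state D (insert c M)).
          \<not> touches D C c \<longrightarrow> snd S C = snd (positive_generator D (insert c M)) C) \<longleftrightarrow>
      (\<forall>C \<in> circles D (marked_state D M). \<not> touches D C c \<longrightarrow> snd S C = Plus)"
    using untouched by (auto simp: positive_generator_def)
  also have "\<dots> \<longleftrightarrow> (\<forall>C \<in> negative_circles D S. touches D C c)"
    using assms(3) by (auto simp: negative_circles_def simp flip: not_Minus_iff)
  finally show ?thesis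
    by (subst coefficient_insert[of M]) (use assms in auto)
qed

section \<open>The graph of the positive state\<close>

lemma ends_state_graph [simp]: "ends (state_graph D s) c = {C \<in> circles D s. touches D C c}"
  by (simp add: state_graph_def)

abbreviation plus_graph :: "'a diagram \<Rightarrow> ('a set, nat) multigraph" where
  "plus_graph D \<equiv> state_graph D (all_plus D)"

context
  fixes D :: "'a diagram"
  assumes pd: "pd_code D" and adequate: "plus_adequate D"
begin

lemma ends_two_circles:
  assumes "e < num_crossings D"
  defines "A \<equiv> circle_of D (marked_state D {}) (arc_at D e 0)"
    and "B \<equiv> circle_of D (marked_state D {}) (arc_at D e 2)"
  shows "ends (plus_graph D) e = {A, B}" "A \<noteq> B"
proof -
  show AB: "ends (plus_graph D) e = {A, B}"
    unfolding ends_state_graph A_def B_def all_plus_eq_marked_state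
    by (rule touching_circles[OF pd assms(1)])
  have "e \<in> edges (plus_graph D)" using assms(1) by (simp add: state_graph_def)
  then have "card (ends (plus_graph D) e) \<noteq> 1"
    using adequate by (auto simp: plus_adequate_def is_loop_def)
  then show "A \<noteq> B" unfolding AB by auto
qed

text \<open>
  A negative marker at \<open>e\<close> contracts the edge \<open>e\<close>: the circles of the new state are the
  vertices of the quotient of the state graph by \<open>e\<close>.
\<close>

lemma circles_one_marker:
  assumes "e < num_crossings D"
  shows "circles D (marked_state D {e}) = insert (\<Union> (ends (plus_graph D) e)) (circles D (all_plus D) - ends (plus_graph D) e)"
    and "card (circles D (marked_state D {e})) = card (circles D (all_plus D)) - 1"
proof -
  note E = ends_two_circles[OF assms]
  show "circles D (marked_state D {e}) = insert (\<Union> (ends (plus_graph D) e)) (circles D (all_plus D) - ends (plus_graph D) e)"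
    unfolding E(1) Union_insert Union_empty Un_empty_right
    unfolding all_plus_eq_marked_state
    by (rule circles_merge(1)[OF pd assms _ _ _ refl refl E(2)]) (use assms in auto)
  show "card (circles D (marked_state D {e})) = card (circles D (all_plus D)) - 1"
    unfolding all_plus_eq_marked_state
    by (rule circles_merge(2)[OF pd assms _ _ _ refl refl E(2)]) (use assms in auto)
qed

text \<open>Contracting \<open>e\<close> turns only the edges parallel to \<open>e\<close> into loops.\<close>

lemma touching_circles_after_merge:
  assumes e: "e < num_crossings D" and f: "f < num_crossings D"
    and ends: "ends (plus_graph D) e \<noteq> ends (plus_graph D) f"
  shows "circle_of D (marked_state D {e}) (arc_at D f 0) \<noteq>
    circle_of D (marked_state D {e}) (arc_at D f 2)"
proof -
  define A where "A = circle_of D (marked_state D {}) (arc_at D e 0)"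
  define B where "B = circle_of D (marked_state D {}) (arc_at D e 2)"
  note E = ends_two_circles[OF e, folded A_def B_def]
  note F = ends_two_circles[OF f]
  have merge: "circle_of D (marked_state D {e}) x =
      (if x \<in> A \<union> B then A \<union> B else circle_of D (marked_state D {}) x)" for x
    by (rule circle_of_merge[OF pd e _ _ _ A_def B_def E(2)]) (use e in auto)
  have mem: "circle_of D (marked_state D {}) x \<in> {A, B}" if "x \<in> A \<union> B" for x
    using that unfolding A_def B_def by (auto dest: circle_of_eq_if_mem)
  let ?p = "arc_at D f 0" and ?q = "arc_at D f 2"
  have self: "?p \<in> circle_of D (marked_state D {}) ?p" "?q \<in> circle_of D (marked_state D {}) ?q"
    by (rule mem_circle_of_self)+
  show ?thesis
  proof
    assume eq: "circle_of D (marked_state D {e}) ?p = circle_of D (marked_state D {e}) ?q"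
    consider "?p \<in> A \<union> B" "?q \<in> A \<union> B" | "?p \<in> A \<union> B" "?q \<notin> A \<union> B"
      | "?p \<notin> A \<union> B" "?q \<in> A \<union> B" | "?p \<notin> A \<union> B" "?q \<notin> A \<union> B"
      by blast
    then show False
    proof cases
      case 1
      then have "ends (plus_graph D) f = {A, B}"
        using mem[of ?p] mem[of ?q] F by auto
      then show False using ends E(1) by simp
    next
      case 2
      then have "circle_of D (marked_state D {}) ?q = A \<union> B"
        using eq merge[of ?p] merge[of ?q] by (simp only: if_True if_False)
      then show False using self(2) 2 by blast
    next
      case 3
      then have "circle_of D (marked_state D {}) ?p = A \<union> B"
        using eq merge[of ?p] merge[of ?q] by (simp only: if_True if_False)
      then show False using self(1) 3 by blast
    next
      case 4
      then show False using eq F(2) by (simp only: merge if_True if_False)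
    qed
  qed
qed

lemma card_touching_circles_after_merge:
  assumes e: "e < num_crossings D" and f: "f < num_crossings D"
    and ends: "ends (plus_graph D) e \<noteq> ends (plus_graph D) f"
  shows "card {C \<in> circles D (marked_state D {e}). touches D C f} = 2"
  unfolding touching_circles[OF pd f] using touching_circles_after_merge[OF assms] by simp

lemma card_circles_two_markers:
  assumes e: "e < num_crossings D" and f: "f < num_crossings D"
    and ends: "ends (plus_graph D) e \<noteq> ends (plus_graph D) f"
  shows "card (circles D (marked_state D {f, e})) = card (circles D (all_plus D)) - 2"
proof -
  have "card (circles D (marked_state D {f, e})) = card (circles D (marked_state D {e})) - 1"
    by (rule circles_merge(2)[OF pd f _ _ _ refl refl touching_circles_after_merge[OF assms]])
      (use f ends in auto)
  then show ?thesis using circles_one_marker(2)[OF e] by simp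
qed

lemma card_circles_ge_2:
  assumes "e < num_crossings D"
  shows "card (circles D (all_plus D)) \<ge> 2"
proof -
  have "card (ends (plus_graph D) e) = 2" using ends_two_circles[OF assms] by simp
  moreover have "ends (plus_graph D) e \<subseteq> circles D (all_plus D)" by auto
  ultimately show ?thesis
    using card_mono[OF finite_circles[OF pd]] by metis
qed

text \<open>
  The new vertex \<open>A \<union> B\<close> meets the edges of \<open>F\<close> other than \<open>e\<close> that meet \<open>A\<close> or \<open>B\<close>, an odd number
  of each kind; no edge is of both kinds, because it would be parallel to \<open>e\<close>.
\<close>

lemma even_degree_after_contraction:
  assumes F: "F \<subseteq> {..<num_crossings D}"
    and even: "\<And>C. C \<in> circles D (all_plus D) \<Longrightarrow> even (card {f \<in> F. touches D C f})"
    and simple: "inj_on (ends (plus_graph D)) F"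
    and e: "e \<in> F" and C: "C \<in> circles D (marked_state D {e})"
  shows "even (card {f \<in> F - {e}. touches D C f})"
proof -
  have eN: "e < num_crossings D" and fin: "finite F" using F e by (auto intro: finite_subset)
  obtain A B where AB: "ends (plus_graph D) e = {A, B}" "A \<noteq> B" using ends_two_circles[OF eN] by blast
  then have A: "A \<in> circles D (all_plus D)" "touches D A e"
    and B: "B \<in> circles D (all_plus D)" "touches D B e" by auto
  show ?thesis
  proof (cases "C = A \<union> B")
    case True
    have "\<not> (touches D A f \<and> touches D B f)" if f: "f \<in> F - {e}" for f
    proof
      assume "touches D A f \<and> touches D B f"
      then have "ends (plus_graph D) e \<subseteq> ends (plus_graph D) f" unfolding AB using A B by auto
      moreover have "card (ends (plus_graph D) e) = 2" "card (ends (plus_graph D) f) = 2" "finite (ends (plus_graph D) f)"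
        using ends_two_circles[of e] ends_two_circles[of f] eN f F by auto
      ultimately have "ends (plus_graph D) e = ends (plus_graph D) f" by (simp add: card_subset_eq)
      then show False using inj_onD[OF simple, of e f] f e by blast
    qed
    then have disj: "({f \<in> F. touches D A f} - {e}) \<inter> ({f \<in> F. touches D B f} - {e}) = {}"
      by auto
    have "{f \<in> F - {e}. touches D C f} = ({f \<in> F. touches D A f} - {e}) \<union> ({f \<in> F. touches D B f} - {e})"
      using True by (auto simp: touches_def)
    also have "card \<dots> = (card {f \<in> F. touches D A f} - 1) + (card {f \<in> F. touches D B f} - 1)"
      using A B e fin disj by (subst card_Un_disjoint) auto
    finally have *: "card {f \<in> F - {e}. touches D C f} =
      (card {f \<in> F. touches D A f} - 1) + (card {f \<in> F. touches D B f} - 1)" .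
    have "card {f \<in> F. touches D X f} > 0" if "touches D X e" for X
      using that e fin by (subst card_gt_0_iff) auto
    then have "card {f \<in> F. touches D A f} > 0" "card {f \<in> F. touches D B f} > 0"
      using A B by blast+
    then show ?thesis
      unfolding * using even[OF A(1)] even[OF B(1)] by presburger
  next
    case False
    then have C0: "C \<in> circles D (all_plus D)" "C \<notin> ends (plus_graph D) e"
      using C AB unfolding circles_one_marker(1)[OF eN] by auto
    then have "{f \<in> F - {e}. touches D C f} = {f \<in> F. touches D C f}" by auto
    then show ?thesis using even[OF C0(1)] by simp
  qed
qed

end

lemma even_degree_cycle:
  assumes cyc: "is_cycle G n vs es"
    and loopless: "\<And>e. e \<in> set es \<Longrightarrow> \<not> is_loop G e"
  shows "even (card {e \<in> set es. v \<in> ends G e})"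
proof -
  from cyc have n: "n \<ge> 1" and len: "length vs = n" "length es = n"
    and dist: "distinct vs" "distinct es"
    and ends: "\<And>i. i < n \<Longrightarrow> ends G (es ! i) = {vs ! i, vs ! ((i + 1) mod n)}"
    by (auto simp: is_cycle_def)
  have ne: "vs ! i \<noteq> vs ! ((i + 1) mod n)" if "i < n" for i
  proof -
    have "es ! i \<in> set es" "es ! i \<in> edges G" using cyc that len by (auto simp: is_cycle_def)
    then have "card (ends G (es ! i)) \<noteq> 1" using loopless by (auto simp: is_loop_def)
    then show ?thesis using ends[OF that] by auto
  qed
  let ?I = "{i. i < n \<and> vs ! i = v}" and ?J = "{i. i < n \<and> vs ! ((i + 1) mod n) = v}"
  have inj: "inj_on (\<lambda>i. (i + 1) mod n) {..<n}"
    by (rule inj_onI) (auto simp: mod_if split: if_splits)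
  then have surj: "(\<lambda>i. (i + 1) mod n) ` {..<n} = {..<n}"
    using n by (intro endo_inj_surj) auto
  \<comment> \<open>The cycle leaves \<open>v\<close> as often as it arrives at \<open>v\<close>.\<close>
  have "?I = (\<lambda>i. (i + 1) mod n) ` ?J"
  proof (intro equalityI subsetI)
    fix i assume i: "i \<in> ?I"
    then have "i \<in> (\<lambda>i. (i + 1) mod n) ` {..<n}" unfolding surj by simp
    then obtain k where "k < n" "i = (k + 1) mod n" by blast
    with i show "i \<in> (\<lambda>i. (i + 1) mod n) ` ?J" by blast
  qed (use n in auto)
  then have "card ?I = card ?J"
    using inj by (metis (no_types, lifting) card_image inj_on_subset mem_Collect_eq lessThan_iff subsetI)
  moreover have "?I \<inter> ?J = {}"
  proof -
    have "\<not> (vs ! i = v \<and> vs ! ((i + 1) mod n) = v)" if "i < n" for i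
      using ne[OF that] by metis
    then show ?thesis by blast
  qed
  ultimately have "card (?I \<union> ?J) = 2 * card ?J" by (subst card_Un_disjoint) auto
  moreover have "{e \<in> set es. v \<in> ends G e} = (!) es ` (?I \<union> ?J)"
  proof -
    have iff: "v \<in> ends G (es ! i) \<longleftrightarrow> i \<in> ?I \<union> ?J" if "i < n" for i
      using ends[OF that] that by auto
    show ?thesis
    proof (intro equalityI subsetI)
      fix e assume "e \<in> {e \<in> set es. v \<in> ends G e}"
      then obtain i where "i < n" "e = es ! i" "v \<in> ends G (es ! i)"
        using len(2) by (auto simp: in_set_conv_nth)
      then show "e \<in> (!) es ` (?I \<union> ?J)" using iff by blast
    next
      fix e assume "e \<in> (!) es ` (?I \<union> ?J)"
      then obtain i where i: "i \<in> ?I \<union> ?J" "e = es ! i" by blast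
      then have "i < n" by blast
      then show "e \<in> {e \<in> set es. v \<in> ends G e}" using i iff len(2) nth_mem by blast
    qed
  qed
  moreover have "inj_on ((!) es) (?I \<union> ?J)"
    using dist(2) len(2) by (intro inj_on_nth) auto
  ultimately show ?thesis by (simp add: card_image)
qed

lemma cycle_ends_inj:
  assumes cyc: "is_cycle G n vs es" and n: "n \<ge> 3"
  shows "inj_on (ends G) (set es)"
proof (rule inj_onI)
  from cyc have len: "length vs = n" "length es = n" and dist: "distinct vs"
    and ends: "\<And>i. i < n \<Longrightarrow> ends G (es ! i) = {vs ! i, vs ! ((i + 1) mod n)}"
    by (auto simp: is_cycle_def)
  fix e f assume "e \<in> set es" "f \<in> set es" and eq: "ends G e = ends G f"
  then obtain i j where ij: "i < n" "j < n" "e = es ! i" "f = es ! j"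
    using len by (auto simp: in_set_conv_nth)
  have nth: "vs ! a = vs ! b \<longleftrightarrow> a = b" if "a < n" "b < n" for a b
    using that dist len by (simp add: nth_eq_iff_index_eq)
  have "{vs ! i, vs ! ((i + 1) mod n)} = {vs ! j, vs ! ((j + 1) mod n)}"
    using eq ends ij by simp
  then have "i = j \<or> (i = (j + 1) mod n \<and> j = (i + 1) mod n)"
    using ij n by (auto simp: doubleton_eq_iff nth)
  then have "i = j"
    using ij(1,2) n by (auto simp: mod_if split: if_splits)
  then show "e = f" using ij by simp
qed

section \<open>The differential in coordinates\<close>

lemma even_signed_count:
  assumes "finite A"
  shows "even (\<Sum>a\<in>A. if P a then (-1::int) ^ k a else 0) \<longleftrightarrow> even (card {a \<in> A. P a})"
proof -
  have "{a \<in> A. odd (if P a then (-1::int) ^ k a else 0)} = {a \<in> A. P a}"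
    by auto
  then show ?thesis by (simp only: even_sum_iff[OF assms])
qed

text \<open>The functional used below sums over all two-element subsets, of which only those through \<open>e\<close> contribute.\<close>

lemma sum_two_subsets:
  fixes h :: "'b set \<Rightarrow> 'c::comm_monoid_add"
  assumes fin: "finite F" and e: "e \<in> F"
    and zero: "\<And>p. p \<subseteq> F \<Longrightarrow> card p = 2 \<Longrightarrow> e \<notin> p \<Longrightarrow> h p = 0"
  shows "(\<Sum>p | p \<subseteq> F \<and> card p = 2. h p) = (\<Sum>f\<in>F - {e}. h {f, e})"
proof -
  have inj: "inj_on (\<lambda>f. {f, e}) (F - {e})"
    by (rule inj_onI) (auto simp: doubleton_eq_iff)
  have "(\<Sum>f\<in>F - {e}. h {f, e}) = (\<Sum>p\<in>(\<lambda>f. {f, e}) ` (F - {e}). h p)"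
    by (simp add: sum.reindex[OF inj])
  also have "\<dots> = (\<Sum>p | p \<subseteq> F \<and> card p = 2. h p)"
  proof (rule sum.mono_neutral_left)
    show "(\<lambda>f. {f, e}) ` (F - {e}) \<subseteq> {p. p \<subseteq> F \<and> card p = 2}"
      using e by auto
    show "\<forall>p\<in>{p. p \<subseteq> F \<and> card p = 2} - (\<lambda>f. {f, e}) ` (F - {e}). h p = 0"
    proof
      fix p assume p: "p \<in> {p. p \<subseteq> F \<and> card p = 2} - (\<lambda>f. {f, e}) ` (F - {e})"
      have "e \<notin> p"
      proof
        assume "e \<in> p"
        then obtain f where "p = {f, e}" "f \<noteq> e"
          using p by (auto simp: card_2_iff)
        then show False using p by auto
      qed
      then show "h p = 0" using p zero by auto
    qed
  qed (use fin in auto)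
  finally show ?thesis by simp
qed

context
  fixes D :: "'a diagram"
  assumes pd: "pd_code D"
begin

lemma lookup_khovanov_d_frag_of:
  assumes "S' \<in> chain_generators D (i - 2) j"
  shows "Poly_Mapping.lookup (khovanov_d D i j (frag_of S)) S' = coefficient D S S'"
  using assms finite_chain_generators[OF pd]
  by (simp add: khovanov_d_def lookup_sum coefficient_def when_def sum.If_cases if_distrib
      cong: if_cong)

lemma lookup_khovanov_d:
  assumes "S' \<in> chain_generators D (i - 2) j"
  shows "Poly_Mapping.lookup (khovanov_d D i j x) S' =
    (\<Sum>S\<in>Poly_Mapping.keys x. Poly_Mapping.lookup x S * coefficient D S S')"
proof -
  have "khovanov_d D i j x =
      (\<Sum>S\<in>Poly_Mapping.keys x. frag_cmul (Poly_Mapping.lookup x S) (khovanov_d D i j (frag_of S)))"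
    by (simp add: khovanov_d_def frag_extend_def)
  then show ?thesis
    by (simp add: lookup_sum lookup_khovanov_d_frag_of[OF assms])
qed

lemma lookup_khovanov_d_sum:
  assumes "S' \<in> chain_generators D (i - 2) j" "finite I"
  shows "Poly_Mapping.lookup (khovanov_d D i j (\<Sum>k\<in>I. frag_cmul (a k) (frag_of (g k)))) S' =
    (\<Sum>k\<in>I. a k * coefficient D (g k) S')"
proof -
  have "khovanov_d D i j (\<Sum>k\<in>I. frag_cmul (a k) (frag_of (g k))) =
      (\<Sum>k\<in>I. frag_cmul (a k) (khovanov_d D i j (frag_of (g k))))"
    unfolding khovanov_d_def by (simp add: frag_extend_sum[OF assms(2)] frag_extend_cmul)
  then show ?thesis
    by (simp add: lookup_sum lookup_khovanov_d_frag_of[OF assms(1)])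
qed

lemma keys_khovanov_d: "Poly_Mapping.keys (khovanov_d D i j x) \<subseteq> chain_generators D (i - 2) j"
  unfolding khovanov_d_def frag_extend_def
  by (intro order_trans[OF keys_sum] UN_least order_trans[OF keys_cmul]) auto

end

section \<open>Torsion from halving a boundary\<close>

text \<open>
  If \<open>2 x\<close> is a boundary and \<open>x\<close> is not, the class of \<open>x\<close> has order two.
\<close>

lemma has_Z2_torsion_if_half_boundary:
  assumes x: "x \<in> carrier (khovanov_chains D i j)" "khovanov_d D i j x = 0"
    and y: "y \<in> carrier (khovanov_chains D (i + 2) j)" "khovanov_d D (i + 2) j y = frag_cmul 2 x"
    and not: "x \<notin> khovanov_d D (i + 2) j ` carrier (khovanov_chains D (i + 2) j)"
  shows "has_Z2_torsion (khovanov_homology D i j)"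
proof -
  define B where "B = khovanov_d D (i + 2) j ` carrier (khovanov_chains D (i + 2) j)"
  define Z where "Z = kernel (khovanov_chains D i j) (khovanov_chains D (i - 2) j) (khovanov_d D i j)"
  define H where "H = khovanov_homology D i j"
  define coset where "coset a = (\<lambda>b. b + a) ` B" for a :: "'a enhanced_state \<Rightarrow>\<^sub>0 int"
  have add: "a + b \<in> B" if "a \<in> B" "b \<in> B" for a b
  proof -
    obtain u v where uv: "Poly_Mapping.keys u \<subseteq> chain_generators D (i + 2) j" "a = khovanov_d D (i + 2) j u"
        "Poly_Mapping.keys v \<subseteq> chain_generators D (i + 2) j" "b = khovanov_d D (i + 2) j v"
      using \<open>a \<in> B\<close> \<open>b \<in> B\<close> by (auto simp: B_def khovanov_chains_def)
    have "a + b = khovanov_d D (i + 2) j (u + v)"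
      by (simp add: uv khovanov_d_def frag_extend_add)
    moreover have "Poly_Mapping.keys (u + v) \<subseteq> chain_generators D (i + 2) j"
      using Poly_Mapping.keys_add[of u v] uv by blast
    ultimately show ?thesis by (auto simp: B_def khovanov_chains_def)
  qed
  have minus: "- a \<in> B" if a: "a \<in> B" for a
  proof -
    obtain u where u: "Poly_Mapping.keys u \<subseteq> chain_generators D (i + 2) j" "a = khovanov_d D (i + 2) j u"
      using a by (auto simp: B_def khovanov_chains_def)
    have "- a = khovanov_d D (i + 2) j (- u)"
      by (simp add: u khovanov_d_def frag_extend_minus)
    then show ?thesis using u by (auto simp: B_def khovanov_chains_def)
  qed
  have zero: "0 \<in> B"
    by (auto simp: B_def khovanov_chains_def khovanov_d_def intro!: image_eqI[of _ _ 0])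
  have xx: "x + x \<in> B"
  proof -
    have "frag_cmul 2 x = x + x"
      using frag_cmul_distrib[of 1 1 x] by simp
    then show ?thesis unfolding B_def using y by (intro image_eqI[of _ _ y]) simp_all
  qed
  have coset_eq_iff: "coset a = coset b \<longleftrightarrow> a - b \<in> B" for a b
  proof
    assume "coset a = coset b"
    then have "0 + a \<in> coset b" using zero unfolding coset_def by blast
    then obtain c where "c \<in> B" "a = c + b" by (auto simp: coset_def)
    then show "a - b \<in> B" by simp
  next
    have sub: "coset a \<subseteq> coset b" if "a - b \<in> B" for a b
    proof
      fix u assume "u \<in> coset a"
      then obtain c where "c \<in> B" "u = c + a" by (auto simp: coset_def)
      then have "u = (c + (a - b)) + b" "c + (a - b) \<in> B" using add that by auto
      then show "u \<in> coset b" unfolding coset_def by blast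
    qed
    assume ab: "a - b \<in> B"
    then have "b - a \<in> B" using minus by fastforce
    with ab show "coset a = coset b" using sub by blast
  qed
  have Z: "0 \<in> Z" "x \<in> Z"
    using x by (auto simp: Z_def kernel_def khovanov_chains_def khovanov_d_def)
  have H: "H = (khovanov_chains D i j)\<lparr>carrier := Z\<rparr> Mod B"
    by (simp add: H_def khovanov_homology_def Z_def B_def)
  have "B #>\<^bsub>(khovanov_chains D i j)\<lparr>carrier := Z\<rparr>\<^esub> a = coset a" for a
    by (auto simp: r_coset_def coset_def khovanov_chains_def)
  then have carrier_H: "carrier H = coset ` Z"
    by (auto simp: H FactGroup_def RCOSETS_def)
  have one_H: "\<one>\<^bsub>H\<^esub> = coset 0"
    by (simp add: H FactGroup_def coset_def)
  have mult_H: "coset a \<otimes>\<^bsub>H\<^esub> coset b = coset (a + b)" for a b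
  proof -
    have "coset a \<otimes>\<^bsub>H\<^esub> coset b = {u + v | u v. u \<in> coset a \<and> v \<in> coset b}"
      by (auto simp: H FactGroup_def set_mult_def khovanov_chains_def)
    also have "\<dots> = coset (a + b)"
    proof (intro equalityI subsetI)
      fix w assume "w \<in> {u + v | u v. u \<in> coset a \<and> v \<in> coset b}"
      then obtain c d where "c \<in> B" "d \<in> B" "w = (c + a) + (d + b)" by (auto simp: coset_def)
      then have "w = (c + d) + (a + b)" "c + d \<in> B" using add by (auto simp: algebra_simps)
      then show "w \<in> coset (a + b)" unfolding coset_def by blast
    next
      fix w assume "w \<in> coset (a + b)"
      then obtain c where "c \<in> B" "w = (c + a) + (0 + b)" by (auto simp: coset_def algebra_simps)
      then show "w \<in> {u + v | u v. u \<in> coset a \<and> v \<in> coset b}"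
        using zero unfolding coset_def by blast
    qed
    finally show ?thesis .
  qed
  have inv_H: "inv\<^bsub>H\<^esub> (coset a) = coset a" if "a \<in> Z" "a + a \<in> B" for a
    unfolding m_inv_def
  proof (rule the_equality)
    show "coset a \<in> carrier H \<and> coset a \<otimes>\<^bsub>H\<^esub> coset a = \<one>\<^bsub>H\<^esub> \<and> coset a \<otimes>\<^bsub>H\<^esub> coset a = \<one>\<^bsub>H\<^esub>"
      using that by (auto simp: carrier_H mult_H one_H coset_eq_iff)
    fix w assume w: "w \<in> carrier H \<and> coset a \<otimes>\<^bsub>H\<^esub> w = \<one>\<^bsub>H\<^esub> \<and> w \<otimes>\<^bsub>H\<^esub> coset a = \<one>\<^bsub>H\<^esub>"
    then obtain b where b: "w = coset b" by (auto simp: carrier_H)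
    then have "a + b \<in> B" using w by (simp add: mult_H one_H coset_eq_iff)
    then have "(a + b) + - (a + a) \<in> B" using add minus that by blast
    then show "w = coset a" unfolding b coset_eq_iff by (simp add: algebra_simps)
  qed
  let ?K = "{coset 0, coset x}"
  have ne: "coset 0 \<noteq> coset x"
    using not minus[of "- x"] by (auto simp: coset_eq_iff B_def)
  have table: "coset 0 \<otimes>\<^bsub>H\<^esub> coset 0 = coset 0" "coset 0 \<otimes>\<^bsub>H\<^esub> coset x = coset x"
    "coset x \<otimes>\<^bsub>H\<^esub> coset 0 = coset x" "coset x \<otimes>\<^bsub>H\<^esub> coset x = coset 0"
    using xx by (auto simp: mult_H coset_eq_iff)
  have "subgroup ?K H"
    by (rule subgroup.intro)
      (use Z xx zero table in \<open>auto simp: carrier_H one_H inv_H\<close>)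
  moreover have "(\<lambda>w. if w = coset 0 then 0 else 1) \<in> iso (H\<lparr>carrier := ?K\<rparr>) (integer_mod_group 2)"
  proof (rule isoI)
    show "(\<lambda>w. if w = coset 0 then 0 else 1) \<in> hom (H\<lparr>carrier := ?K\<rparr>) (integer_mod_group 2)"
      by (rule homI) (use ne table in \<open>auto simp: carrier_integer_mod_group\<close>)
    have "{0..<int 2} = {0, 1}" by auto
    then show "bij_betw (\<lambda>w. if w = coset 0 then 0 else 1) (carrier (H\<lparr>carrier := ?K\<rparr>))
        (carrier (integer_mod_group 2))"
      using ne by (auto simp: bij_betw_def carrier_integer_mod_group inj_on_def)
  qed
  ultimately show ?thesis
    unfolding has_Z2_torsion_def is_iso_def H_def by blast
qed

section \<open>The torsion class of a singular edge\<close>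

text \<open>
  The sign with which the differential changes the marker at \<open>f\<close> when exactly the marker at \<open>e\<close> is
  negative: a minus sign if \<open>e\<close> is bigger than \<open>f\<close>.
\<close>

definition pair_sign :: "nat \<Rightarrow> nat \<Rightarrow> int" where
  "pair_sign e f = (-1) ^ card {c \<in> {e}. f < c}"

text \<open>
  In the gradings of \<open>torsion_generators\<close> below, the generator with a negative marker at \<open>e\<close> and
  negative circle \<open>C\<close> stands for the vertex \<open>C\<close> of the graph contracted along \<open>e\<close>, and the
  positive generator with negative markers at \<open>e\<close> and \<open>f\<close> for the edge \<open>f\<close> of that graph.
  The factor 1 in the vertex sum gives it the shape of a general linear combination, to which
  \<open>lookup_khovanov_d_sum\<close> applies.
\<close>

definition contracted_edge_sum :: "'a diagram \<Rightarrow> nat \<Rightarrow> 'a enhanced_state \<Rightarrow>\<^sub>0 int" where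
  "contracted_edge_sum D e =
     (\<Sum>f\<in>{..<num_crossings D} - {e}. frag_cmul (pair_sign e f) (frag_of (positive_generator D {f, e})))"

definition contracted_vertex_sum :: "'a diagram \<Rightarrow> nat \<Rightarrow> 'a enhanced_state \<Rightarrow>\<^sub>0 int" where
  "contracted_vertex_sum D e =
     (\<Sum>C\<in>circles D (marked_state D {e}). frag_cmul 1 (frag_of (one_negative_generator D {e} C)))"

text \<open>
  The second grading is that of the generators without negative markers and with two negative
  circles; \<open>k\<close> is the number of negative markers.
\<close>

abbreviation torsion_generators :: "'a diagram \<Rightarrow> nat \<Rightarrow> 'a enhanced_state set" where
  "torsion_generators D k \<equiv>
     chain_generators D (int (num_crossings D) - 2 * int k)
       (int (num_crossings D) + 2 * (int (card (circles D (all_plus D))) - 4))"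

context
  fixes D :: "'a diagram"
  assumes pd: "pd_code D" and adequate: "plus_adequate D"
begin

lemma one_marker_generatorE:
  assumes "S \<in> torsion_generators D 1"
  obtains g C where "g < num_crossings D" "C \<in> circles D (marked_state D {g})"
    "S = one_negative_generator D {g} C"
proof -
  obtain M where M: "M \<subseteq> {..<num_crossings D}" "card M = 1" "fst S = marked_state D M"
    "S \<in> enhanced_states D" and count:
    "int (card (circles D (marked_state D M))) = int 1 + (int (card (circles D (all_plus D))) - 4)
        + 2 * int (card (negative_circles D S))"
    by (rule chain_generatorE[OF pd assms])
  obtain g where g: "M = {g}" using M(2) by (auto simp: card_1_singleton_iff)
  then have gN: "g < num_crossings D" using M(1) by auto
  have "card (negative_circles D S) = 1"
    using count circles_one_marker(2)[OF pd adequate gN] card_circles_ge_2[OF pd adequate gN] g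
    by simp
  then obtain C where C: "negative_circles D S = {C}" by (auto simp: card_1_singleton_iff)
  have "S = one_negative_generator D {g} C"
    using one_negative_generator_unique[OF pd M(4) _ C] M(3) g by simp
  moreover have "C \<in> circles D (marked_state D {g})"
    using C M(3) g by (auto simp: negative_circles_def)
  ultimately show thesis using gN that by blast
qed

lemma one_negative_generator_mem:
  assumes e: "e < num_crossings D" and C: "C \<in> circles D (marked_state D {e})"
  shows "one_negative_generator D {e} C \<in> torsion_generators D 1"
proof -
  have M: "{e} \<subseteq> {..<num_crossings D}" using e by simp
  show ?thesis
    unfolding mem_chain_generators_iff[OF pd M fst_generators(2) refl]
    using circles_one_marker(2)[OF pd adequate e] card_circles_ge_2[OF pd adequate e]
      negative_circles_generators(2)[OF pd C]
    by (simp add: generators_enhanced[OF pd])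
qed

lemma positive_generator_mem:
  assumes e: "e < num_crossings D" and f: "f < num_crossings D"
    and ends: "ends (plus_graph D) e \<noteq> ends (plus_graph D) f"
  shows "positive_generator D {f, e} \<in> torsion_generators D 2"
proof -
  have M: "{f, e} \<subseteq> {..<num_crossings D}" and "f \<noteq> e" using e f ends by auto
  then have "card {f, e} = 2" by simp
  then show ?thesis
    unfolding mem_chain_generators_iff[OF pd M fst_generators(1) refl]
    using card_circles_two_markers[OF pd adequate e f ends] card_circles_ge_2[OF pd adequate e]
      negative_circles_generators(1)[OF pd]
    by (simp add: generators_enhanced[OF pd])
qed

lemma coefficient_one_negative_positive:
  assumes e: "e < num_crossings D" and f: "f < num_crossings D" and ne: "f \<noteq> e"
    and C: "C \<in> circles D (marked_state D {e})"
  shows "coefficient D (one_negative_generator D {e} C) (positive_generator D {f, e}) =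
    (if touches D C f then pair_sign e f else 0)"
  by (subst coefficient_into_positive[OF pd, of "{e}"])
    (use e f ne C in \<open>auto simp: negative_circles_generators(2)[OF pd] pair_sign_def\<close>)

context
  fixes e :: nat
  assumes e: "e < num_crossings D"
    and singular: "\<And>f. f < num_crossings D \<Longrightarrow> f \<noteq> e \<Longrightarrow> ends (plus_graph D) e \<noteq> ends (plus_graph D) f"
begin

lemma lookup_contracted_edge_sum:
  assumes f: "f < num_crossings D" "f \<noteq> e"
  shows "Poly_Mapping.lookup (contracted_edge_sum D e) (positive_generator D {f, e}) = pair_sign e f"
proof -
  have "positive_generator D {f, e} = positive_generator D {f', e} \<longleftrightarrow> f' = f"
    if "f' < num_crossings D" "f' \<noteq> e" for f'
    using f that e by (subst positive_generator_eq_iff) (auto simp: doubleton_eq_iff)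
  then have "Poly_Mapping.lookup (contracted_edge_sum D e) (positive_generator D {f, e}) =
      (\<Sum>f'\<in>{..<num_crossings D} - {e}. if f' = f then pair_sign e f' else 0)"
    unfolding contracted_edge_sum_def lookup_sum
    by (intro sum.cong) (auto simp: when_def)
  also have "\<dots> = pair_sign e f" using f by (subst sum.delta) auto
  finally show ?thesis .
qed

lemma lookup_contracted_edge_sum_eq_0:
  assumes "\<And>f. f < num_crossings D \<Longrightarrow> f \<noteq> e \<Longrightarrow> S \<noteq> positive_generator D {f, e}"
  shows "Poly_Mapping.lookup (contracted_edge_sum D e) S = 0"
  unfolding contracted_edge_sum_def lookup_sum
  by (rule sum.neutral) (use assms in \<open>auto simp: when_def\<close>)

lemma keys_contracted_edge_sum: "Poly_Mapping.keys (contracted_edge_sum D e) \<subseteq> torsion_generators D 2"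
proof
  fix S assume "S \<in> Poly_Mapping.keys (contracted_edge_sum D e)"
  then obtain f where "f < num_crossings D" "f \<noteq> e" "S = positive_generator D {f, e}"
    using lookup_contracted_edge_sum_eq_0 by (metis in_keys_iff)
  then show "S \<in> torsion_generators D 2"
    using positive_generator_mem[OF e _ singular] by simp
qed

lemma keys_contracted_vertex_sum: "Poly_Mapping.keys (contracted_vertex_sum D e) \<subseteq> torsion_generators D 1"
  unfolding contracted_vertex_sum_def
  by (intro order_trans[OF keys_sum] UN_least order_trans[OF keys_cmul])
    (use one_negative_generator_mem[OF e] in simp)

text \<open>
  A vertex is mapped to the signed sum of the edges at it, and every edge of the contracted graph
  has two distinct ends, because \<open>e\<close> is singular.  The sign depends on the edge only.
\<close>

lemma khovanov_d_contracted_vertex_sum: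
  assumes "i = int (num_crossings D) - 2"
    and "j = int (num_crossings D) + 2 * (int (card (circles D (all_plus D))) - 4)"
  shows "khovanov_d D i j (contracted_vertex_sum D e) = frag_cmul 2 (contracted_edge_sum D e)"
proof (rule poly_mapping_eqI)
  fix S'
  have gens: "chain_generators D (i - 2) j = torsion_generators D 2"
    using assms by simp
  show "Poly_Mapping.lookup (khovanov_d D i j (contracted_vertex_sum D e)) S' =
      Poly_Mapping.lookup (frag_cmul 2 (contracted_edge_sum D e)) S'"
  proof (cases "S' \<in> torsion_generators D 2")
    case False
    then have "S' \<notin> Poly_Mapping.keys (khovanov_d D i j (contracted_vertex_sum D e))"
      "S' \<notin> Poly_Mapping.keys (contracted_edge_sum D e)"
      using keys_khovanov_d[OF pd, of i j] keys_contracted_edge_sum unfolding gens by blast+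
    then show ?thesis by (simp add: in_keys_iff)
  next
    case True
    then obtain M where M: "M \<subseteq> {..<num_crossings D}" "card M = 2" "fst S' = marked_state D M"
      "S' \<in> enhanced_states D" and count:
      "int (card (circles D (marked_state D M))) = int 2 + (int (card (circles D (all_plus D))) - 4)
          + 2 * int (card (negative_circles D S'))"
      by (rule chain_generatorE[OF pd])
    have d: "Poly_Mapping.lookup (khovanov_d D i j (contracted_vertex_sum D e)) S' =
        (\<Sum>C\<in>circles D (marked_state D {e}). coefficient D (one_negative_generator D {e} C) S')"
      unfolding contracted_vertex_sum_def
      by (subst lookup_khovanov_d_sum[OF pd]) (use True gens finite_circles[OF pd] in auto)
    show ?thesis
    proof (cases "e \<in> M")
      case True
      then obtain f where f: "M = {f, e}" "f \<noteq> e" using M(2) by (auto simp: card_2_iff)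
      then have fN: "f < num_crossings D" using M(1) by auto
      have "negative_circles D S' = {}"
        using count card_circles_two_markers[OF pd adequate e fN singular[OF fN f(2)]]
          card_circles_ge_2[OF pd adequate e] finite_negative_circles[OF pd] f(1)
        by (simp add: card_eq_0_iff)
      then have S': "S' = positive_generator D {f, e}"
        using positive_generator_unique[OF pd M(4)] M(3) f(1) by simp
      have "Poly_Mapping.lookup (khovanov_d D i j (contracted_vertex_sum D e)) S' =
          (\<Sum>C\<in>circles D (marked_state D {e}). if touches D C f then pair_sign e f else 0)"
        unfolding d unfolding S'
        by (intro sum.cong refl coefficient_one_negative_positive e fN f(2))
      also have "\<dots> = pair_sign e f * int (card {C \<in> circles D (marked_state D {e}). touches D C f})"
        by (simp add: sum.If_cases finite_circles[OF pd] Int_def)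
      also have "\<dots> = 2 * pair_sign e f"
        using card_touching_circles_after_merge[OF pd adequate e fN singular[OF fN f(2)]] by simp
      finally show ?thesis using lookup_contracted_edge_sum[OF fN f(2)] S' by simp
    next
      case False
      have "coefficient D (one_negative_generator D {e} C) S' = 0" for C
        by (rule coefficient_eq_0_if_marker_lost[of "{e}" _ _ M]) (use e M False in auto)
      moreover have "Poly_Mapping.lookup (contracted_edge_sum D e) S' = 0"
      proof (rule lookup_contracted_edge_sum_eq_0)
        fix f assume "f < num_crossings D" "f \<noteq> e"
        show "S' \<noteq> positive_generator D {f, e}"
        proof
          assume "S' = positive_generator D {f, e}"
          then have "marked_state D M e = marked_state D {f, e} e" using M(3) by simp
          then show False using False e by simp
        qed
      qed
      ultimately show ?thesis using d by simp
    qed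
  qed
qed

lemma pair_sign_cancel:
  assumes "f \<noteq> g" "f \<noteq> e" "g \<noteq> e"
  shows "pair_sign e f * (-1) ^ card {c \<in> {f, e}. g < c} + pair_sign e g * (-1) ^ card {c \<in> {g, e}. f < c} = 0"
proof -
  have *: "card {c \<in> {a, e}. b < c} = of_bool (b < a) + card {c \<in> {e}. b < c}" if "a \<noteq> e" for a b
  proof -
    have "{c \<in> {a, e}. b < c} = (if b < a then insert a {c \<in> {e}. b < c} else {c \<in> {e}. b < c})"
      by auto
    then show ?thesis using that by simp
  qed
  show ?thesis
    using assms unfolding *[OF assms(2)] *[OF assms(3)] pair_sign_def
    by (cases "f < g") (auto simp: power_add)
qed

text \<open>
  A third negative marker raises the number of circles by at most one, and the gradings then leave
  room for no negative circle.  Hence a target is the positive generator of some \<open>{e, f, g}\<close>; it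
  is reached from \<open>{e, f}\<close> and from \<open>{e, g}\<close>, with opposite signs.
\<close>

lemma khovanov_d_contracted_edge_sum:
  assumes "i = int (num_crossings D) - 4"
    and "j = int (num_crossings D) + 2 * (int (card (circles D (all_plus D))) - 4)"
  shows "khovanov_d D i j (contracted_edge_sum D e) = 0"
proof (rule poly_mapping_eqI)
  fix S'
  let ?R = "{..<num_crossings D} - {e}"
  have gens: "chain_generators D (i - 2) j = torsion_generators D 3"
    using assms by simp
  show "Poly_Mapping.lookup (khovanov_d D i j (contracted_edge_sum D e)) S' = Poly_Mapping.lookup 0 S'"
  proof (cases "S' \<in> torsion_generators D 3")
    case False
    then have "S' \<notin> Poly_Mapping.keys (khovanov_d D i j (contracted_edge_sum D e))"
      using keys_khovanov_d[OF pd, of i j] unfolding gens by blast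
    then show ?thesis by (simp add: in_keys_iff)
  next
    case True
    then obtain M where M: "M \<subseteq> {..<num_crossings D}" "card M = 3" "fst S' = marked_state D M"
      "S' \<in> enhanced_states D" and count:
      "int (card (circles D (marked_state D M))) = int 3 + (int (card (circles D (all_plus D))) - 4)
          + 2 * int (card (negative_circles D S'))"
      by (rule chain_generatorE[OF pd])
    let ?t = "\<lambda>f. pair_sign e f * coefficient D (positive_generator D {f, e}) S'"
    have d: "Poly_Mapping.lookup (khovanov_d D i j (contracted_edge_sum D e)) S' = (\<Sum>f\<in>?R. ?t f)"
      unfolding contracted_edge_sum_def
      by (subst lookup_khovanov_d_sum[OF pd]) (use True gens in auto)
    have nz: "\<exists>g. g < num_crossings D \<and> g \<notin> {f, e} \<and> M = insert g {f, e}"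
      if fR: "f \<in> ?R" and nonzero: "coefficient D (positive_generator D {f, e}) S' \<noteq> 0" for f
    proof -
      have "{f, e} \<subseteq> {..<num_crossings D}" "card {f, e} = 2" using fR e by auto
      then obtain g where "g < num_crossings D" "g \<notin> {f, e}" "M = insert g {f, e}"
        using coefficient_nonzeroE[OF _ fst_generators(1) M(1,3) _ nonzero] M(2) by auto
      then show ?thesis by blast
    qed
    show ?thesis
    proof (cases "\<exists>f\<in>?R. coefficient D (positive_generator D {f, e}) S' \<noteq> 0")
      case False
      then show ?thesis unfolding d by simp
    next
      case True
      then obtain f where f: "f \<in> ?R" "coefficient D (positive_generator D {f, e}) S' \<noteq> 0" by blast
      then obtain g where g: "g < num_crossings D" "g \<notin> {f, e}" "M = insert g {f, e}"
        using nz by blast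
      have fN: "f < num_crossings D" "f \<noteq> e" using f by auto
      have "card (circles D (marked_state D M)) \<le> card (circles D (marked_state D {f, e})) + 1"
        by (rule card_circles_change_marker[OF pd g(1)]) (use g in auto)
      then have "card (negative_circles D S') = 0"
        using count card_circles_two_markers[OF pd adequate e fN(1) singular[OF fN]]
          card_circles_ge_2[OF pd adequate e] by linarith
      then have "negative_circles D S' = {}"
        using finite_negative_circles[OF pd] by simp
      then have S': "S' = positive_generator D M"
        using positive_generator_unique[OF pd M(4)] M(3) by simp
      have coef: "coefficient D (positive_generator D {a, e}) S' = (-1) ^ card {c \<in> {a, e}. b < c}"
        if "M = insert b {a, e}" "a < num_crossings D" "b < num_crossings D" "b \<notin> {a, e}" for a b
        unfolding S' that(1)
        by (subst coefficient_into_positive[OF pd])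
          (use that e in \<open>auto simp: negative_circles_generators(1)[OF pd]\<close>)
      have "(\<Sum>a\<in>?R. ?t a) = (\<Sum>a\<in>{f, g}. ?t a)"
      proof (rule sum.mono_neutral_right)
        show "{f, g} \<subseteq> ?R" using f g by auto
        show "\<forall>a\<in>?R - {f, g}. ?t a = 0"
        proof
          fix a assume a: "a \<in> ?R - {f, g}"
          then have "a \<notin> M" using g by auto
          then show "?t a = 0" using nz[of a] a by auto
        qed
      qed simp
      also have "\<dots> = ?t f + ?t g" using g by simp
      also have "\<dots> = 0"
      proof -
        have "coefficient D (positive_generator D {f, e}) S' = (-1) ^ card {c \<in> {f, e}. g < c}"
          by (rule coef) (use g fN in auto)
        moreover have "coefficient D (positive_generator D {g, e}) S' = (-1) ^ card {c \<in> {g, e}. f < c}"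
          by (rule coef) (use g fN in auto)
        moreover have "f \<noteq> g" "g \<noteq> e" using g(2) by auto
        note pair_sign_cancel[OF this(1) fN(2) this(2)]
        ultimately show ?thesis by (simp only:)
      qed
      finally show ?thesis unfolding d by simp
    qed
  qed
qed

text \<open>
  Summing the coefficients at the positive generators of all pairs of edges in \<open>F\<close> separates the
  edge sum from the boundaries.  On the boundary of a generator (one negative marker \<open>g\<close>, negative
  circle \<open>C\<close>) the sum vanishes if \<open>g\<close> is outside \<open>F\<close>, and otherwise is modulo 2 the degree of \<open>C\<close> in
  the graph of \<open>F\<close> contracted along \<open>g\<close>, which is even.  On the edge sum, the pairs through \<open>e\<close>
  contribute one sign each, and their number \<open>card F - 1\<close> is odd.
\<close>

lemma edge_sum_not_boundary:
  assumes F: "F \<subseteq> {..<num_crossings D}" "e \<in> F" "even (card F)"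
    and degree: "\<And>C. C \<in> circles D (all_plus D) \<Longrightarrow> even (card {f \<in> F. touches D C f})"
    and simple: "inj_on (ends (plus_graph D)) F"
    and ij: "i = int (num_crossings D) - 2"
      "j = int (num_crossings D) + 2 * (int (card (circles D (all_plus D))) - 4)"
    and z: "Poly_Mapping.keys z \<subseteq> torsion_generators D 1"
  shows "khovanov_d D i j z \<noteq> contracted_edge_sum D e"
proof
  assume eq: "khovanov_d D i j z = contracted_edge_sum D e"
  let ?P = "{p. p \<subseteq> F \<and> card p = 2}"
  have fin: "finite F" using F(1) by (rule finite_subset) simp
  have gens: "chain_generators D (i - 2) j = torsion_generators D 2"
    using ij by simp
  have mem: "positive_generator D p \<in> torsion_generators D 2" if pP: "p \<in> ?P" for p
  proof -
    obtain f g where p: "p = {f, g}" "f \<noteq> g" using pP by (auto simp: card_2_iff)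
    then have fg: "f \<in> F" "g \<in> F" using pP by auto
    then have "ends (plus_graph D) g \<noteq> ends (plus_graph D) f"
      using inj_onD[OF simple, of g f] p(2) by blast
    then show ?thesis using positive_generator_mem[of g f] fg F(1) unfolding p(1) by blast
  qed
  have row: "even (\<Sum>p\<in>?P. coefficient D S (positive_generator D p))"
    if S: "S \<in> torsion_generators D 1" for S
  proof -
    obtain g C where g: "g < num_crossings D" and C: "C \<in> circles D (marked_state D {g})"
      and S_eq: "S = one_negative_generator D {g} C"
      using one_marker_generatorE[OF S] by blast
    have zero: "coefficient D S (positive_generator D p) = 0" if "p \<subseteq> F" "card p = 2" "g \<notin> p" for p
      by (rule coefficient_eq_0_if_marker_lost[of "{g}" _ _ p]) (use g that F(1) S_eq in auto)
    show ?thesis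
    proof (cases "g \<in> F")
      case False
      then have "(\<Sum>p\<in>?P. coefficient D S (positive_generator D p)) = 0"
        by (intro sum.neutral) (use zero in auto)
      then show ?thesis by simp
    next
      case True
      have "(\<Sum>p\<in>?P. coefficient D S (positive_generator D p)) =
          (\<Sum>f\<in>F - {g}. coefficient D S (positive_generator D {f, g}))"
        by (rule sum_two_subsets[OF fin True]) (rule zero)
      also have "\<dots> = (\<Sum>f\<in>F - {g}. if touches D C f then (-1) ^ card {c \<in> {g}. f < c} else 0)"
        unfolding S_eq
        by (intro sum.cong refl) (use coefficient_one_negative_positive[OF g _ _ C] F(1) in \<open>auto simp: pair_sign_def\<close>)
      finally show ?thesis
        using even_signed_count[of "F - {g}"] fin
          even_degree_after_contraction[OF pd adequate F(1) degree simple True C]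
        by simp
    qed
  qed
  have "(\<Sum>p\<in>?P. Poly_Mapping.lookup (khovanov_d D i j z) (positive_generator D p)) =
      (\<Sum>p\<in>?P. \<Sum>S\<in>Poly_Mapping.keys z. Poly_Mapping.lookup z S * coefficient D S (positive_generator D p))"
    by (intro sum.cong refl lookup_khovanov_d[OF pd]) (use mem gens in simp)
  also have "\<dots> = (\<Sum>S\<in>Poly_Mapping.keys z. Poly_Mapping.lookup z S *
      (\<Sum>p\<in>?P. coefficient D S (positive_generator D p)))"
    by (subst sum.swap) (simp add: sum_distrib_left)
  also have "even \<dots>"
    by (intro dvd_sum dvd_mult row) (use z in auto)
  finally have even_sum: "even (\<Sum>p\<in>?P. Poly_Mapping.lookup (contracted_edge_sum D e) (positive_generator D p))"
    unfolding eq .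
  have "(\<Sum>p\<in>?P. Poly_Mapping.lookup (contracted_edge_sum D e) (positive_generator D p)) =
      (\<Sum>f\<in>F - {e}. Poly_Mapping.lookup (contracted_edge_sum D e) (positive_generator D {f, e}))"
  proof (rule sum_two_subsets[OF fin F(2)])
    fix p assume p: "p \<subseteq> F" "card p = 2" "e \<notin> p"
    show "Poly_Mapping.lookup (contracted_edge_sum D e) (positive_generator D p) = 0"
    proof (rule lookup_contracted_edge_sum_eq_0)
      fix f assume "f < num_crossings D" "f \<noteq> e"
      then show "positive_generator D p \<noteq> positive_generator D {f, e}"
        using p F(1) e by (subst positive_generator_eq_iff) auto
    qed
  qed
  also have "\<dots> = (\<Sum>f\<in>F - {e}. if True then (-1) ^ card {c \<in> {e}. f < c} else 0)"
    by (intro sum.cong refl) (use lookup_contracted_edge_sum F(1) in \<open>auto simp: pair_sign_def\<close>)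
  finally have "even (\<Sum>f\<in>F - {e}. if True then (-1::int) ^ card {c \<in> {e}. f < c} else 0)"
    by (rule subst[where P = even]) (rule even_sum)
  then have "even (card {f \<in> F - {e}. True})"
    by (subst (asm) even_signed_count) (use fin in auto)
  also have "{f \<in> F - {e}. True} = F - {e}" by auto
  finally have "even (card (F - {e}))" .
  moreover have "card F = Suc (card (F - {e}))"
    using F(2) fin by (rule card.remove[rotated])
  ultimately show False using F(3) by simp
qed

end

end

lemma singular_edge_ends_unique:
  assumes pd: "pd_code D" and adequate: "plus_adequate D"
    and singular: "singular_edge (plus_graph D) e"
    and f: "f < num_crossings D" "f \<noteq> e"
  shows "ends (plus_graph D) e \<noteq> ends (plus_graph D) f"
proof
  assume eq: "ends (plus_graph D) e = ends (plus_graph D) f"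
  have e: "e < num_crossings D" using singular by (simp add: singular_edge_def state_graph_def)
  obtain A B where AB: "ends (plus_graph D) e = {A, B}" "A \<noteq> B"
    using ends_two_circles[OF pd adequate e] by blast
  have "A \<in> circles D (all_plus D)" "B \<in> circles D (all_plus D)"
    using AB(1) by auto
  then have "is_cycle (plus_graph D) 2 [A, B] [e, f]"
    unfolding is_cycle_def
    using AB eq e f by (auto simp: less_2_cases_iff state_graph_def)
  then show False using singular unfolding singular_edge_def by (metis list.set_intros(1))
qed

theorem theorem3p2:
  fixes D :: "'a diagram" and N n :: nat
  assumes "link_diagram D"
    and "connected_diagram D"
    and "num_crossings D = N"
    and "plus_adequate D"
    and "even n"
    and "\<exists>vs es e. is_cycle (state_graph D (all_plus D)) n vs es \<and> e \<in> set es \<and>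
           singular_edge (state_graph D (all_plus D)) e"
  shows "has_Z2_torsion
           (khovanov_homology D (int N - 4) (int N + 2 * int (card (circles D (all_plus D))) - 8))"
proof -
  have pd: "pd_code D" using assms(1) by (simp add: link_diagram_def)
  note adequate = \<open>plus_adequate D\<close>
  obtain vs es e where cyc: "is_cycle (plus_graph D) n vs es" and e: "e \<in> set es"
    and singular: "singular_edge (plus_graph D) e"
    using assms(6) by blast
  have len: "length es = n" "distinct es" "n \<ge> 1" and es: "set es \<subseteq> {..<num_crossings D}"
    using cyc by (auto simp: is_cycle_def state_graph_def)
  have eN: "e < num_crossings D" using e es by auto
  \<comment> \<open>A cycle of length 2 through \<open>e\<close> would be a 2-gon, and longer cycles have no parallel edges.\<close>
  have "n \<noteq> 2" using singular cyc e by (auto simp: singular_edge_def)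
  with \<open>even n\<close> len(3) have n: "n \<ge> 3" by presburger
  note unique = singular_edge_ends_unique[OF pd adequate singular]
  let ?i = "int (num_crossings D) - 4"
    and ?j = "int (num_crossings D) + 2 * (int (card (circles D (all_plus D))) - 4)"
  have up: "?i + 2 = int (num_crossings D) - 2" by simp
  have gens2: "chain_generators D ?i ?j = torsion_generators D 2" by simp
  have gens1: "chain_generators D (?i + 2) ?j = torsion_generators D 1" by simp
  have degree: "even (card {f \<in> set es. touches D C f})" if "C \<in> circles D (all_plus D)" for C
    using even_degree_cycle[OF cyc, of C] adequate that
    by (simp add: plus_adequate_def)
  have "has_Z2_torsion (khovanov_homology D ?i ?j)"
  proof (rule has_Z2_torsion_if_half_boundary)
    show "contracted_edge_sum D e \<in> carrier (khovanov_chains D ?i ?j)"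
      unfolding khovanov_chains_def carrier_free_Abelian_group_iff gens2
      by (rule keys_contracted_edge_sum[OF pd adequate eN unique])
    show "contracted_vertex_sum D e \<in> carrier (khovanov_chains D (?i + 2) ?j)"
      unfolding khovanov_chains_def carrier_free_Abelian_group_iff gens1
      by (rule keys_contracted_vertex_sum[OF pd adequate eN unique])
    show "khovanov_d D ?i ?j (contracted_edge_sum D e) = 0"
      by (rule khovanov_d_contracted_edge_sum[OF pd adequate eN unique refl refl])
    show "khovanov_d D (?i + 2) ?j (contracted_vertex_sum D e) = frag_cmul 2 (contracted_edge_sum D e)"
      by (rule khovanov_d_contracted_vertex_sum[OF pd adequate eN unique up refl])
    have no: "khovanov_d D (?i + 2) ?j z \<noteq> contracted_edge_sum D e"
      if "Poly_Mapping.keys z \<subseteq> chain_generators D (?i + 2) ?j" for z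
      by (rule edge_sum_not_boundary[OF pd adequate eN unique es e _ degree
            cycle_ends_inj[OF cyc n] up refl that[unfolded gens1]])
        (use \<open>even n\<close> len in \<open>auto simp: distinct_card\<close>)
    show "contracted_edge_sum D e \<notin> khovanov_d D (?i + 2) ?j ` carrier (khovanov_chains D (?i + 2) ?j)"
    proof
      assume "contracted_edge_sum D e \<in> khovanov_d D (?i + 2) ?j ` carrier (khovanov_chains D (?i + 2) ?j)"
      then obtain z where z: "contracted_edge_sum D e = khovanov_d D (?i + 2) ?j z"
        "z \<in> carrier (khovanov_chains D (?i + 2) ?j)"
        by (rule imageE)
      from z(2) have "Poly_Mapping.keys z \<subseteq> chain_generators D (?i + 2) ?j"
        by (simp only: khovanov_chains_def carrier_free_Abelian_group_iff)
      from no[OF this] z(1)[symmetric] show False by (rule notE)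
    qed
  qed
  moreover have "?j = int N + 2 * int (card (circles D (all_plus D))) - 8"
    using assms(3) by simp
  ultimately show ?thesis unfolding assms(3) by (simp only:)
qed

end
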